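(* For any $f\in L^\infty(\mathbb{R}_+)$ and constant $\alpha$, $K(f)=\alpha$ if and only if $f_\omega = \alpha$ (almost everywhere on $\mathbb{R}$) for every $\omega\in\mathscr{O}$.
   Context: $\mathbb{R}_+=[0,\infty)$; functions are complex-valued. $K(f)=\alpha$ means that $f(\cdot+s)$ converges, as $s\to\infty$, to the constant $\alpha$ in the weak* topology of $L^\infty(\mathbb{R}_+)=L^1(\mathbb{R}_+)^*$. Let $\beta\mathbb{N}$ be the Stone–Čech compactification of $\mathbb{N}$, $\mathbb{N}^*=\beta\mathbb{N}\setminus\mathbb{N}$, $\tau$ the continuous extension of $n\mapsto n+1$. $\Omega$ is the quotient of $\beta\mathbb{N}\times[0,1]$ identifying $(\eta,1)$ with $(\tau\eta,0)$; $\Omega^*$ consists of classes $(\eta,u)$ with $\eta\in\mathbb{N}^*$; $\tau^s(\eta,u)=(\tau^{[u+s]}\eta,u+s-[u+s])$ for $s\in\mathbb{R}$ defines a flow on $\Omega^*$. $\mathscr{O}$ is a set containing exactly one representative of each orbit $\{\tau^x\omega : x\in\mathbb{R}\}$ in $\Omega^*$. Each $\omega=(\eta,u)$ is identified with the ultrafilter on $\mathbb{R}_+$ generated by $\{u+A:A\in\eta\}$. For $f\in L^\infty(\mathbb{R}_+)$, $f_\omega := \omega\text{-}\lim_s f(\cdot+s)$ (limit along this ultrafilter in the weak* topology of $L^\infty(\mathbb{R}_+)$), extended to $L^\infty(\mathbb{R})$ by $f_\omega(x) = f_{\tau^{-N}\omega}(N+x)$ for $x\in[-N,0]$, $N>0$.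 *)

theory Defs
  imports "HOL-Analysis.Analysis"
begin

definition Linf_Rp :: "(real \<Rightarrow> complex) set" where
  "Linf_Rp = {f. set_borel_measurable lebesgue {0..} f \<and>
                 (\<exists>C. AE x in lebesgue. x \<ge> 0 \<longrightarrow> norm (f x) \<le> C)}"

definition L1_Rp :: "(real \<Rightarrow> complex) set" where
  "L1_Rp = {g. set_integrable lebesgue {0..} g}"

definition pair_shift :: "(real \<Rightarrow> complex) \<Rightarrow> (real \<Rightarrow> complex) \<Rightarrow> real \<Rightarrow> complex" where
  "pair_shift f g s = (LINT x:{0..}|lebesgue. f (x + s) * g x)"

text \<open>K(f) = alpha: f(.+s) tends weak-* to the constant alpha as s tends to infinity\<close>
definition K_is :: "(real \<Rightarrow> complex) \<Rightarrow> complex \<Rightarrow> bool" where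
  "K_is f \<alpha> \<longleftrightarrow> (\<forall>g \<in> L1_Rp.
      ((\<lambda>s. pair_shift f g s) \<longlongrightarrow> \<alpha> * (LINT x:{0..}|lebesgue. g x)) at_top)"

section \<open>Stone-Cech compactification of N as ultrafilters\<close>

definition ultra :: "nat filter \<Rightarrow> bool" where
  "ultra F \<longleftrightarrow> F \<noteq> bot \<and> (\<forall>P. eventually P F \<or> eventually (\<lambda>x. \<not> P x) F)"

definition betaN :: "nat filter set" where
  "betaN = {F. ultra F}"

definition Nstar :: "nat filter set" where
  "Nstar = {F. ultra F \<and> (\<forall>n. eventually (\<lambda>x. x \<noteq> n) F)}"

text \<open>tau^k on N* for integer k (tau = extension of n \<mapsto> n+1; negative k gives the inverse on N*)\<close>
definition tau_pow :: "int \<Rightarrow> nat filter \<Rightarrow> nat filter" where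
  "tau_pow k \<eta> = filtermap (\<lambda>n. nat (int n + k)) \<eta>"

text \<open>points of Omega* are represented by their canonical representatives (eta,u), u in [0,1)\<close>
definition OmegaStar :: "(nat filter \<times> real) set" where
  "OmegaStar = {(\<eta>, u). \<eta> \<in> Nstar \<and> 0 \<le> u \<and> u < 1}"

definition flow :: "real \<Rightarrow> nat filter \<times> real \<Rightarrow> nat filter \<times> real" where
  "flow s \<omega> = (tau_pow \<lfloor>snd \<omega> + s\<rfloor> (fst \<omega>), snd \<omega> + s - of_int \<lfloor>snd \<omega> + s\<rfloor>)"

definition orbit :: "nat filter \<times> real \<Rightarrow> (nat filter \<times> real) set" where
  "orbit \<omega> = {flow s \<omega> | s. True}"

definition orbit_reps :: "(nat filter \<times> real) set \<Rightarrow> bool" where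
  "orbit_reps Reps \<longleftrightarrow> Reps \<subseteq> OmegaStar \<and> (\<forall>\<omega> \<in> OmegaStar. \<exists>!r. r \<in> Reps \<and> r \<in> orbit \<omega>)"

definition omega_filter :: "nat filter \<times> real \<Rightarrow> real filter" where
  "omega_filter \<omega> = filtermap (\<lambda>n. snd \<omega> + real n) (fst \<omega>)"

definition is_omega_lim :: "(real \<Rightarrow> complex) \<Rightarrow> nat filter \<times> real \<Rightarrow> (real \<Rightarrow> complex) \<Rightarrow> bool" where
  "is_omega_lim f \<omega> h \<longleftrightarrow> h \<in> Linf_Rp \<and> (\<forall>g \<in> L1_Rp.
      ((\<lambda>s. pair_shift f g s) \<longlongrightarrow> (LINT x:{0..}|lebesgue. h x * g x)) (omega_filter \<omega>))"

definition f_omega_Rp :: "(real \<Rightarrow> complex) \<Rightarrow> nat filter \<times> real \<Rightarrow> real \<Rightarrow> complex" where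
  "f_omega_Rp f \<omega> = (SOME h. is_omega_lim f \<omega> h)"

text \<open>extension to R: for x in [-N,0], f_omega(x) = f_{tau^{-N} omega}(N + x), here with N = ceiling(-x)\<close>
definition f_omega :: "(real \<Rightarrow> complex) \<Rightarrow> nat filter \<times> real \<Rightarrow> real \<Rightarrow> complex" where
  "f_omega f \<omega> x = (if 0 \<le> x then f_omega_Rp f \<omega> x
      else (let N = \<lceil>- x\<rceil> in f_omega_Rp f (flow (- of_int N) \<omega>) (of_int N + x)))"

end

theory Submission
  imports Defs
begin

(* Both sides of the equivalence are statements about the weak-* limits of the translates
   f(. + s) along the ultrafilters omega in Omega*.  If f(. + s) tends to alpha, every omega-limit
   is alpha.  Conversely, f_omega = alpha on the whole line says that the omega-limit is alpha at
   every point tau^(-N) omega of the orbit, and since omega-limits are equivariant under the flow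
   (f_(tau^d omega) = f_omega(. + d)), at every point of the orbit; thus the limit is alpha along
   every omega in Omega*.  Since translation is continuous in L1, the pairing of f(. + s) with a
   fixed g is uniformly continuous in s, so convergence along every free ultrafilter on each
   progression u + N yields convergence as s tends to infinity.
   The omega-limits exist because bounded sequences converge along ultrafilters and bounded
   functionals on L1 are represented by L-infinity functions (via Radon-Nikodym). *)

section \<open>Free ultrafilters and the flow on Omega*\<close>

definition is_ultrafilter :: "'a filter \<Rightarrow> bool" where
  "is_ultrafilter F \<longleftrightarrow> F \<noteq> bot \<and> (\<forall>P. eventually P F \<or> eventually (\<lambda>x. \<not> P x) F)"

lemma ultra_eq_is_ultrafilter: "ultra = is_ultrafilter"
  by (simp add: fun_eq_iff ultra_def is_ultrafilter_def)

lemma is_ultrafilter_filtermap: "is_ultrafilter F \<Longrightarrow> is_ultrafilter (filtermap g F)"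
  by (auto simp: is_ultrafilter_def eventually_filtermap filtermap_bot_iff)

lemma is_ultrafilter_bounded_convergent:
  fixes \<phi> :: "'a \<Rightarrow> 'b::{real_normed_vector, heine_borel}"
  assumes F: "is_ultrafilter F" and bounded: "eventually (\<lambda>s. norm (\<phi> s) \<le> B) F"
  shows "\<exists>L. (\<phi> \<longlongrightarrow> L) F"
proof -
  let ?G = "filtermap \<phi> F"
  have "?G \<noteq> bot" using F by (simp add: is_ultrafilter_def filtermap_bot_iff)
  moreover have "eventually (\<lambda>x. x \<in> cball 0 B) ?G" using bounded by (simp add: eventually_filtermap)
  ultimately obtain L where L: "inf (nhds L) ?G \<noteq> bot"
    using compact_filter[THEN iffD1, OF compact_cball] by blast
  have "eventually (\<lambda>s. \<phi> s \<in> S) F" if "open S" "L \<in> S" for S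
  proof (rule ccontr)
    assume "\<not> eventually (\<lambda>s. \<phi> s \<in> S) F"
    then have "eventually (\<lambda>x. x \<notin> S) ?G" using F by (auto simp: is_ultrafilter_def eventually_filtermap)
    moreover have "eventually (\<lambda>x. x \<in> S) (nhds L)" using that by (rule eventually_nhds_in_open)
    ultimately have "eventually (\<lambda>x. False) (inf (nhds L) ?G)"
      unfolding eventually_inf by blast
    with L show False by (simp add: trivial_limit_def)
  qed
  then show ?thesis by (auto simp: tendsto_def)
qed

lemma exists_maximal_filter_le:
  fixes F :: "'a filter"
  assumes F: "F \<noteq> bot"
  obtains U where "U \<noteq> bot" "U \<le> F" "\<And>G. G \<noteq> bot \<Longrightarrow> G \<le> U \<Longrightarrow> G = U"
proof -
  let ?R = "{(b, a). a \<noteq> bot \<and> a \<le> b \<and> b \<le> F}"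
  have bot_notin_R: "c \<in> Chains ?R \<Longrightarrow> bot \<notin> c" for c
    by (auto simp: Chains_def)
  have [simp]: "Field ?R = {G. G \<noteq> bot \<and> G \<le> F}"
    by (auto simp: Field_def bot_unique)
  have "\<exists>m\<in>Field ?R. \<forall>a\<in>Field ?R. (m, a) \<in> ?R \<longrightarrow> a = m"
  proof (rule Zorns_po_lemma)
    show "Partial_order ?R"
      by (auto simp: partial_order_on_def preorder_on_def
          antisym_def refl_on_def trans_def Field_def bot_unique)
    show "\<exists>u\<in>Field ?R. \<forall>a\<in>C. (a, u) \<in> ?R" if C: "C \<in> Chains ?R" for C
    proof (simp, intro exI conjI ballI)
      have Inf_C: "Inf C \<noteq> bot" "Inf C \<le> F" if "C \<noteq> {}"
      proof -
        from C that have "Inf C = bot \<longleftrightarrow> (\<exists>x\<in>C. x = bot)"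
          unfolding trivial_limit_def by (intro eventually_Inf_base) (auto simp: Chains_def)
        with C show "Inf C \<noteq> bot"
          by (simp add: bot_notin_R)
        from that obtain x where "x \<in> C" by auto
        with C show "Inf C \<le> F"
          by (auto intro!: Inf_lower2[of x] simp: Chains_def)
      qed
      then have [simp]: "inf F (Inf C) = (if C = {} then F else Inf C)"
        using C by (auto simp add: inf_absorb2)
      from C show "inf F (Inf C) \<noteq> bot"
        by (simp add: F Inf_C)
      from C show "inf F (Inf C) \<le> F"
        by (simp add: Chains_def Inf_C F)
      with C show "inf F (Inf C) \<le> x" "x \<le> F" if "x \<in> C" for x
        using that by (auto intro: Inf_lower simp: Chains_def)
    qed
  qed
  with that show ?thesis by auto
qed

lemma exists_ultrafilter_le:
  fixes F :: "'a filter"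
  assumes "F \<noteq> bot"
  shows "\<exists>U\<le>F. is_ultrafilter U"
proof -
  obtain U where U: "U \<noteq> bot" "U \<le> F" and maximal: "\<And>G. G \<noteq> bot \<Longrightarrow> G \<le> U \<Longrightarrow> G = U"
    using exists_maximal_filter_le[OF assms] by blast
  have "eventually P U" if "\<not> eventually (\<lambda>x. \<not> P x) U" for P
  proof -
    have "inf U (principal {x. P x}) \<noteq> bot"
      using that by (simp add: trivial_limit_def eventually_inf_principal)
    then have "inf U (principal {x. P x}) = U" by (rule maximal) simp
    moreover have "eventually P (inf U (principal {x. P x}))" by (simp add: eventually_inf_principal)
    ultimately show ?thesis by simp
  qed
  with U show ?thesis by (auto simp: is_ultrafilter_def)
qed

lemma Nstar_eventually_ge:
  assumes "\<eta> \<in> Nstar" shows "eventually (\<lambda>n. m \<le> n) \<eta>"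
proof -
  have "\<forall>k\<in>{..<m}. eventually (\<lambda>n. n \<noteq> k) \<eta>" using assms by (auto simp: Nstar_def)
  then have "eventually (\<lambda>n. \<forall>k\<in>{..<m}. n \<noteq> k) \<eta>"
    by (rule eventually_ball_finite[rotated]) simp
  then show ?thesis by eventually_elim (auto simp: not_less[symmetric])
qed

lemma Nstar_ex_eventually_mem:
  fixes S :: "nat set"
  assumes "infinite S"
  shows "\<exists>\<eta>\<in>Nstar. eventually (\<lambda>n. n \<in> S) \<eta>"
proof -
  have "inf cofinite (principal S) \<noteq> bot"
    using assms by (simp add: trivial_limit_def eventually_inf_principal not_eventually frequently_cofinite)
  then obtain U where U: "U \<le> inf cofinite (principal S)" "is_ultrafilter U"
    using exists_ultrafilter_le by blast
  then have "U \<le> cofinite" "U \<le> principal S" by (simp_all add: le_inf_iff)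
  have "eventually (\<lambda>x. x \<noteq> n) U" for n
    using \<open>U \<le> cofinite\<close> by (rule filter_leD) (simp add: eventually_cofinite)
  moreover have "eventually (\<lambda>n. n \<in> S) U"
    using \<open>U \<le> principal S\<close> by (rule filter_leD) (simp add: eventually_principal)
  ultimately show ?thesis
    using U(2) unfolding Nstar_def ultra_eq_is_ultrafilter by blast
qed

lemma tendsto_sequentially_if_tendsto_Nstar:
  assumes "\<And>\<eta>. \<eta> \<in> Nstar \<Longrightarrow> (a \<longlongrightarrow> L) \<eta>"
  shows "(a \<longlongrightarrow> L) sequentially"
proof (rule topological_tendstoI)
  fix S assume S: "open S" "L \<in> S"
  show "eventually (\<lambda>n. a n \<in> S) sequentially"
  proof (rule ccontr)
    assume "\<not> eventually (\<lambda>n. a n \<in> S) sequentially"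
    then have "infinite {n. a n \<notin> S}"
      by (simp add: not_eventually frequently_cofinite flip: cofinite_eq_sequentially)
    then obtain \<eta> where \<eta>: "\<eta> \<in> Nstar" "eventually (\<lambda>n. a n \<notin> S) \<eta>"
      using Nstar_ex_eventually_mem[of "{n. a n \<notin> S}"] by auto
    have "eventually (\<lambda>n. a n \<in> S) \<eta>"
      using assms[OF \<eta>(1)] S by (rule topological_tendstoD)
    with \<eta>(2) have "eventually (\<lambda>n. False) \<eta>" by (rule eventually_elim2) simp
    with \<eta>(1) show False by (simp add: Nstar_def ultra_def)
  qed
qed

lemma filtermap_cong_eventually:
  assumes "eventually (\<lambda>x. f x = g x) F"
  shows "filtermap f F = filtermap g F"
  unfolding filter_eq_iff eventually_filtermap
  using assms by (auto elim: eventually_elim2)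

lemma tau_pow_Nstar:
  assumes "\<eta> \<in> Nstar" shows "tau_pow k \<eta> \<in> Nstar"
proof -
  have "eventually (\<lambda>n. nat (int n + k) \<noteq> m) \<eta>" for m
    using Nstar_eventually_ge[OF assms, of "nat (int m - k + 1)"] by eventually_elim auto
  with assms show ?thesis
    by (auto simp: Nstar_def tau_pow_def ultra_eq_is_ultrafilter is_ultrafilter_filtermap
        eventually_filtermap)
qed

lemma tau_pow_add:
  assumes "\<eta> \<in> Nstar" shows "tau_pow a (tau_pow b \<eta>) = tau_pow (a + b) \<eta>"
proof -
  have "eventually (\<lambda>n. nat (int (nat (int n + b)) + a) = nat (int n + (a + b))) \<eta>"
    using Nstar_eventually_ge[OF assms, of "nat (- b)"] by eventually_elim auto
  then show ?thesis
    unfolding tau_pow_def filtermap_filtermap by (rule filtermap_cong_eventually)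
qed

lemma tau_pow_0 [simp]: "tau_pow 0 \<eta> = \<eta>"
  by (simp add: tau_pow_def filtermap_ident)

lemma flow_OmegaStar: "\<omega> \<in> OmegaStar \<Longrightarrow> flow s \<omega> \<in> OmegaStar"
  by (auto simp: OmegaStar_def flow_def tau_pow_Nstar) linarith

lemma flow_add:
  assumes "\<omega> \<in> OmegaStar" shows "flow a (flow b \<omega>) = flow (a + b) \<omega>"
proof -
  obtain \<eta> u where \<omega>: "\<omega> = (\<eta>, u)" "\<eta> \<in> Nstar" using assms by (auto simp: OmegaStar_def)
  have "\<lfloor>u + b - of_int \<lfloor>u + b\<rfloor> + a\<rfloor> = \<lfloor>u + (a + b)\<rfloor> - \<lfloor>u + b\<rfloor>"
    by (metis add.assoc add.commute add_diff_eq floor_diff_of_int)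
  with \<omega> show ?thesis by (simp add: flow_def tau_pow_add add.commute)
qed

lemma flow_0 [simp]:
  assumes "\<omega> \<in> OmegaStar" shows "flow 0 \<omega> = \<omega>"
proof -
  obtain \<eta> u where \<omega>: "\<omega> = (\<eta>, u)" "0 \<le> u" "u < 1" using assms by (auto simp: OmegaStar_def)
  then have "\<lfloor>u\<rfloor> = 0" by (simp add: floor_eq_iff)
  with \<omega> show ?thesis by (simp add: flow_def)
qed

lemma omega_filter_flow:
  assumes "\<omega> \<in> OmegaStar"
  shows "omega_filter (flow t \<omega>) = filtermap (\<lambda>s. s + t) (omega_filter \<omega>)"
proof -
  obtain \<eta> u where \<omega>: "\<omega> = (\<eta>, u)" "\<eta> \<in> Nstar" using assms by (auto simp: OmegaStar_def)
  have "eventually (\<lambda>n. u + t - of_int \<lfloor>u + t\<rfloor> + real (nat (int n + \<lfloor>u + t\<rfloor>))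
          = u + real n + t) \<eta>"
    using Nstar_eventually_ge[OF \<omega>(2), of "nat (- \<lfloor>u + t\<rfloor>)"] by eventually_elim auto
  with \<omega> show ?thesis
    by (simp add: omega_filter_def flow_def tau_pow_def filtermap_filtermap filtermap_cong_eventually)
qed

lemma omega_filter_ultrafilter: "\<omega> \<in> OmegaStar \<Longrightarrow> is_ultrafilter (omega_filter \<omega>)"
  by (auto simp: OmegaStar_def Nstar_def omega_filter_def ultra_eq_is_ultrafilter
      is_ultrafilter_filtermap)

lemma omega_filter_not_bot: "\<omega> \<in> OmegaStar \<Longrightarrow> omega_filter \<omega> \<noteq> bot"
  using omega_filter_ultrafilter by (auto simp: is_ultrafilter_def)

lemma omega_filter_le_at_top:
  assumes "\<omega> \<in> OmegaStar" shows "omega_filter \<omega> \<le> at_top"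
proof (rule filter_leI)
  obtain \<eta> u where \<omega>: "\<omega> = (\<eta>, u)" "\<eta> \<in> Nstar" "0 \<le> u" using assms by (auto simp: OmegaStar_def)
  fix P :: "real \<Rightarrow> bool" assume "eventually P at_top"
  then obtain S where S: "\<And>x. x \<ge> S \<Longrightarrow> P x" by (auto simp: eventually_at_top_linorder)
  have "eventually (\<lambda>n. nat \<lceil>S\<rceil> \<le> n) \<eta>" by (rule Nstar_eventually_ge[OF \<omega>(2)])
  then have "eventually (\<lambda>n. P (u + real n)) \<eta>"
    by eventually_elim (rule S, use \<omega>(3) in linarith)
  with \<omega> show "eventually P (omega_filter \<omega>)" by (simp add: omega_filter_def eventually_filtermap)
qed

lemma eventually_nonneg_omega_filter: "\<omega> \<in> OmegaStar \<Longrightarrow> eventually (\<lambda>s. 0 \<le> s) (omega_filter \<omega>)"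
  by (rule filter_leD[OF omega_filter_le_at_top]) simp_all

lemma nearest_grid_point_below:
  fixes s :: real and M :: nat
  assumes "0 \<le> s" "0 < M"
  obtains j where "j < M" "real j / real M + real (nat \<lfloor>s\<rfloor>) \<le> s"
    "s < real j / real M + real (nat \<lfloor>s\<rfloor>) + 1 / real M"
proof -
  define n where "n = nat \<lfloor>s\<rfloor>"
  define j where "j = nat \<lfloor>(s - real n) * real M\<rfloor>"
  have "real n = of_int \<lfloor>s\<rfloor>" using assms(1) by (simp add: n_def)
  then have n: "real n \<le> s" "s < real n + 1" by linarith+
  then have j: "real j \<le> (s - real n) * real M" "(s - real n) * real M < real j + 1"
    using assms(2) by (auto simp: j_def)
  have "(s - real n) * real M < 1 * real M" using n assms(2) by (intro mult_strict_right_mono) auto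
  with j(1) have "j < M" by linarith
  moreover have "real j / real M \<le> s - real n" "s - real n < real j / real M + 1 / real M"
    using j assms(2) by (simp_all add: field_simps)
  ultimately show ?thesis using that by (simp add: n_def algebra_simps)
qed

lemma uniformly_continuous_on_tendsto_at_top:
  fixes G :: "real \<Rightarrow> 'a::metric_space"
  assumes uc: "uniformly_continuous_on {0..} G"
    and shifts: "\<And>u. 0 \<le> u \<Longrightarrow> u < 1 \<Longrightarrow> ((\<lambda>n. G (u + real n)) \<longlongrightarrow> L) sequentially"
  shows "(G \<longlongrightarrow> L) at_top"
proof (rule tendstoI)
  fix e :: real assume "e > 0"
  then obtain d where "d > 0" and d: "\<And>x x'. 0 \<le> x \<Longrightarrow> 0 \<le> x' \<Longrightarrow> dist x' x < d \<Longrightarrow> dist (G x') (G x) < e / 2"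
    using uc unfolding uniformly_continuous_on_def by (metis atLeast_iff half_gt_zero)
  obtain m :: nat where "inverse (real (Suc m)) < d" using reals_Archimedean[OF \<open>d > 0\<close>] by blast
  define M where "M = Suc m"
  have M: "0 < M" "1 / real M < d" using \<open>inverse _ < d\<close> by (simp_all add: M_def inverse_eq_divide)
  have "\<forall>j\<in>{..<M}. eventually (\<lambda>n. dist (G (real j / real M + real n)) L < e / 2) sequentially"
  proof
    fix j assume "j \<in> {..<M}"
    then have "0 \<le> real j / real M" "real j / real M < 1" using M(1) by (simp_all add: divide_less_eq)
    from shifts[OF this] show "eventually (\<lambda>n. dist (G (real j / real M + real n)) L < e / 2) sequentially"
      by (rule tendstoD) (simp add: \<open>e > 0\<close>)
  qed
  then have "eventually (\<lambda>n. \<forall>j\<in>{..<M}. dist (G (real j / real M + real n)) L < e / 2) sequentially"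
    by (rule eventually_ball_finite[rotated]) simp
  then obtain N where N: "\<And>n j. N \<le> n \<Longrightarrow> j < M \<Longrightarrow> dist (G (real j / real M + real n)) L < e / 2"
    by (auto simp: eventually_sequentially)
  show "eventually (\<lambda>s. dist (G s) L < e) at_top"
    unfolding eventually_at_top_linorder
  proof (intro exI allI impI)
    fix s :: real assume s: "real N \<le> s"
    then have "0 \<le> s" "N \<le> nat \<lfloor>s\<rfloor>" by (auto simp: le_nat_floor)
    then obtain j where "j < M" and grid: "real j / real M + real (nat \<lfloor>s\<rfloor>) \<le> s"
      "s < real j / real M + real (nat \<lfloor>s\<rfloor>) + 1 / real M"
      using nearest_grid_point_below[OF _ M(1)] by blast
    let ?u = "real j / real M + real (nat \<lfloor>s\<rfloor>)"
    have "dist (G s) (G ?u) < e / 2"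
      using d[of ?u s] grid M(2) \<open>0 \<le> s\<close> by (simp add: dist_real_def)
    moreover have "dist (G ?u) L < e / 2" using N \<open>N \<le> nat \<lfloor>s\<rfloor>\<close> \<open>j < M\<close> by blast
    ultimately show "dist (G s) L < e"
      using dist_triangle[of "G s" L "G ?u"] by linarith
  qed
qed

section \<open>Continuity of translation in L1\<close>

lemma borel_measurable_lebesgue_ident [measurable]: "(\<lambda>x::'a::euclidean_space. x) \<in> borel_measurable lebesgue"
  using id_borel_measurable_lebesgue by (simp add: id_def)

lemma AE_lebesgue_translate:
  assumes "AE x in lebesgue. P x"
  shows "AE x in lebesgue. P (x + t :: real)"
proof -
  obtain N where N: "N \<in> null_sets lebesgue" "{x. \<not> P x} \<subseteq> N"
    using assms by (auto simp: eventually_ae_filter)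
  let ?N = "(\<lambda>x. - t + x) ` N"
  have "(\<lambda>x. 1 *\<^sub>R x + (- t)) ` N = ?N" by (auto simp: add.commute)
  then have "?N \<in> null_sets lebesgue"
    using N lebesgue_sets_translation[of N "- t"] emeasure_lebesgue_affine[of 1 "- t" N]
    by (simp add: null_sets_def null_setsD1[OF N(1)])
  moreover have "{x. \<not> P (x + t)} \<subseteq> ?N"
    using N by (force intro: rev_image_eqI)
  ultimately show ?thesis by (auto simp: eventually_ae_filter)
qed

lemma borel_measurable_lebesgue_translate:
  fixes g :: "real \<Rightarrow> 'a::euclidean_space"
  assumes "g \<in> borel_measurable lebesgue"
  shows "(\<lambda>x. g (x + t)) \<in> borel_measurable lebesgue"
  using borel_measurable_affine[OF assms, of 1 t] by (simp add: add.commute)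

lemma integrable_lebesgue_translate_iff:
  fixes g :: "real \<Rightarrow> 'a::euclidean_space"
  shows "integrable lebesgue (\<lambda>x. g (x + t)) \<longleftrightarrow> integrable lebesgue g"
  using lebesgue_integrable_real_affine_iff[of 1 g t] by (simp add: add.commute)

lemma integral_lebesgue_translate:
  fixes g :: "real \<Rightarrow> 'a::euclidean_space"
  shows "(\<integral>x. g (x + t) \<partial>lebesgue) = (\<integral>x. g x \<partial>lebesgue)"
  using lebesgue_integral_real_affine[of 1 g t] by (simp add: add.commute)

lemma lmeasurable_outer_open:
  assumes "A \<in> lmeasurable" "e > 0"
  obtains U where "open U" "A \<subseteq> U" "U - A \<in> lmeasurable" "measure lebesgue (U - A) < e"
proof -
  obtain U where U: "open U" "A \<subseteq> U" "U - A \<in> lmeasurable" "emeasure lebesgue (U - A) < ennreal e"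
    using sets_lebesgue_outer_open[of A e] assms by (auto simp: fmeasurable_def)
  moreover have "measure lebesgue (U - A) < e"
    using U(3,4) assms(2) by (simp add: emeasure_eq_measure2 ennreal_less_iff)
  ultimately show ?thesis using that by blast
qed

lemma lmeasurable_inner_compact:
  fixes A :: "real set"
  assumes A: "A \<in> lmeasurable" and "e > 0"
  obtains K where "compact K" "K \<subseteq> A" "measure lebesgue (A - K) < e"
proof -
  have "A \<in> sets lebesgue" using A by (simp add: fmeasurable_def)
  then obtain T where T: "closed T" "T \<subseteq> A" "A - T \<in> lmeasurable"
      "emeasure lebesgue (A - T) < ennreal (e / 2)"
    using sets_lebesgue_inner_closed[of A "e / 2"] \<open>e > 0\<close> by auto
  have "measure lebesgue (A - T) < e / 2"
    using T(3,4) \<open>e > 0\<close> by (simp add: emeasure_eq_measure2 ennreal_less_iff)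
  let ?tail = "\<lambda>n::nat. A - {- real n..real n}"
  have tail_lmeasurable: "?tail n \<in> lmeasurable" for n
    using A by (intro fmeasurable_Diff) auto
  have "decseq ?tail" by (auto simp: decseq_def)
  have "\<exists>n. x \<notin> ?tail n" for x
  proof -
    obtain n where "\<bar>x\<bar> \<le> real n" using real_arch_simple by blast
    then have "x \<notin> ?tail n" by (auto simp: abs_le_iff)
    then show ?thesis ..
  qed
  then have "(\<Inter>n. ?tail n) = {}" by blast
  moreover have "(\<lambda>n. measure lebesgue (?tail n)) \<longlonglongrightarrow> measure lebesgue (\<Inter>n. ?tail n)"
    using tail_lmeasurable \<open>decseq ?tail\<close> fmeasurableD2[OF tail_lmeasurable]
    by (intro Lim_measure_decseq) (auto simp del: emeasure_completion simp add: fmeasurableD)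
  ultimately have "(\<lambda>n. measure lebesgue (?tail n)) \<longlonglongrightarrow> 0" by (metis measure_empty)
  then have "eventually (\<lambda>n. measure lebesgue (?tail n) < e / 2) sequentially"
    using \<open>e > 0\<close> by (intro order_tendstoD(2)) auto
  then obtain n where n: "measure lebesgue (?tail n) < e / 2"
    by (meson eventually_sequentially order_refl)
  define K where "K = T \<inter> {- real n..real n}"
  have "compact K" unfolding K_def by (rule closed_Int_compact[OF T(1)]) simp
  have "A - K \<subseteq> (A - T) \<union> ?tail n" by (auto simp: K_def)
  then have "measure lebesgue (A - K) \<le> measure lebesgue ((A - T) \<union> ?tail n)"
    using A T(3) tail_lmeasurable lmeasurable_compact[OF \<open>compact K\<close>]
    by (intro measure_mono_fmeasurable) (auto simp: fmeasurable.Un)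
  also have "\<dots> \<le> measure lebesgue (A - T) + measure lebesgue (?tail n)"
    using T(3) tail_lmeasurable by (intro measure_Un_le) auto
  finally have "measure lebesgue (A - K) \<le> measure lebesgue (A - T) + measure lebesgue (?tail n)" .
  with n \<open>measure lebesgue (A - T) < e / 2\<close> have "measure lebesgue (A - K) < e" by linarith
  with \<open>compact K\<close> show ?thesis using that T(2) by (auto simp: K_def)
qed

lemma compact_subset_open_margin:
  fixes K U :: "'a::euclidean_space set"
  assumes "compact K" "open U" "K \<subseteq> U"
  obtains d where "d > 0" "\<And>y z. y \<in> K \<Longrightarrow> dist y z < d \<Longrightarrow> z \<in> U"
proof (cases "K = {} \<or> U = UNIV")
  case True
  then show ?thesis using that[of 1] by auto
next
  case False
  then have "0 < setdist K (- U)"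
    using assms by (subst setdist_gt_0_compact_closed) auto
  moreover have "z \<in> U" if "y \<in> K" "dist y z < setdist K (- U)" for y z
    using setdist_le_dist[of y K z "- U"] that by (cases "z \<in> U") auto
  ultimately show ?thesis using that by blast
qed

lemma LIM_L1_translate_indicator:
  fixes A :: "real set"
  assumes A: "A \<in> lmeasurable"
  shows "(\<lambda>t. \<integral>x. \<bar>indicat_real A (x + t) - indicat_real A x\<bar> \<partial>lebesgue) \<midarrow>0\<rightarrow> (0::real)"
  unfolding LIM_eq
proof (intro allI impI)
  fix e :: real assume "e > 0"
  obtain U where U: "open U" "A \<subseteq> U" "U - A \<in> lmeasurable" "measure lebesgue (U - A) < e / 8"
    using lmeasurable_outer_open[OF A, of "e / 8"] \<open>e > 0\<close> by auto
  obtain K where K: "compact K" "K \<subseteq> A" "measure lebesgue (A - K) < e / 8"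
    using lmeasurable_inner_compact[OF A, of "e / 8"] \<open>e > 0\<close> by auto
  obtain d where "d > 0" and d: "\<And>y z. y \<in> K \<Longrightarrow> dist y z < d \<Longrightarrow> z \<in> U"
    using compact_subset_open_margin[OF K(1) U(1)] K(2) U(2) by blast
  have AK: "A - K \<in> lmeasurable" using A lmeasurable_compact[OF K(1)] by (auto intro: fmeasurable_Diff)
  have integrable: "integrable lebesgue (\<lambda>x. indicat_real S (x + t))" if "S \<in> lmeasurable" for S :: "real set" and t
    using integrable_lebesgue_translate_iff[of "indicat_real S" t] that
    by (simp add: lmeasurable_iff_integrable)
  have integral: "(\<integral>x. indicat_real S (x + t) \<partial>lebesgue) = measure lebesgue S" if "S \<in> lmeasurable" for S :: "real set" and t
    using integral_lebesgue_translate[of "indicat_real S" t] that by simp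
  have "norm (\<integral>x. \<bar>indicat_real A (x + t) - indicat_real A x\<bar> \<partial>lebesgue) < e" if "\<bar>t\<bar> < d" for t
  proof -
    (* If exactly one of x, x + t lies in A, then one of them lies in A - K or the other in U - A,
       because points closer than d to K lie in U. *)
    let ?g = "\<lambda>x. indicat_real (A - K) (x + t) + indicat_real (U - A) x
      + indicat_real (A - K) x + indicat_real (U - A) (x + t)"
    have shifts: "integrable lebesgue (\<lambda>x. indicat_real S (x + t))" "integrable lebesgue (indicat_real S)"
      if "S \<in> lmeasurable" for S using integrable[OF that, of t] integrable[OF that, of 0] by simp_all
    have "\<bar>indicat_real A (x + t) - indicat_real A x\<bar> \<le> ?g x" for x
      using d[of "x + t" x] d[of x "x + t"] that by (auto simp: indicator_def dist_real_def)
    then have "(\<integral>x. \<bar>indicat_real A (x + t) - indicat_real A x\<bar> \<partial>lebesgue) \<le> (\<integral>x. ?g x \<partial>lebesgue)"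
      using shifts[OF A] shifts[OF AK] shifts[OF U(3)] by (intro integral_mono) auto
    also have "\<dots> = 2 * measure lebesgue (A - K) + 2 * measure lebesgue (U - A)"
      using shifts[OF AK] shifts[OF U(3)] integral[OF AK, of t] integral[OF AK, of 0]
        integral[OF U(3), of t] integral[OF U(3), of 0] by simp
    finally have "(\<integral>x. \<bar>indicat_real A (x + t) - indicat_real A x\<bar> \<partial>lebesgue) < e"
      using K(3) U(4) \<open>e > 0\<close> by linarith
    moreover have "0 \<le> (\<integral>x. \<bar>indicat_real A (x + t) - indicat_real A x\<bar> \<partial>lebesgue)" by simp
    ultimately show ?thesis by simp
  qed
  then show "\<exists>d>0. \<forall>t. t \<noteq> 0 \<and> norm (t - 0) < d \<longrightarrow>
      norm ((\<integral>x. \<bar>indicat_real A (x + t) - indicat_real A x\<bar> \<partial>lebesgue) - 0) < e"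
    using \<open>d > 0\<close> by (auto intro!: exI[of _ d])
qed

lemma L1_translate_diff_le:
  fixes f s :: "real \<Rightarrow> 'a::euclidean_space"
  assumes f: "integrable lebesgue f" and s: "integrable lebesgue s"
  shows "(\<integral>x. norm (f (x + t) - f x) \<partial>lebesgue)
    \<le> 2 * (\<integral>x. norm (s x - f x) \<partial>lebesgue) + (\<integral>x. norm (s (x + t) - s x) \<partial>lebesgue)"
proof -
  have sf: "integrable lebesgue (\<lambda>x. norm (s x - f x))" using s f by simp
  then have sf_shift: "integrable lebesgue (\<lambda>x. norm (s (x + t) - f (x + t)))"
    using integrable_lebesgue_translate_iff[of "\<lambda>x. norm (s x - f x)" t] by simp
  have s_shift: "integrable lebesgue (\<lambda>x. norm (s (x + t) - s x))"
    using s integrable_lebesgue_translate_iff[of s t] by simp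
  have "norm (f (x + t) - f x) \<le> norm (s (x + t) - f (x + t)) + norm (s (x + t) - s x) + norm (s x - f x)" for x
  proof -
    have "f (x + t) - f x = (s (x + t) - s x) + (s x - f x) - (s (x + t) - f (x + t))" by simp
    then have "norm (f (x + t) - f x) \<le> norm ((s (x + t) - s x) + (s x - f x)) + norm (s (x + t) - f (x + t))"
      by (metis norm_triangle_ineq4)
    also have "\<dots> \<le> norm (s (x + t) - s x) + norm (s x - f x) + norm (s (x + t) - f (x + t))"
      by (rule add_right_mono[OF norm_triangle_ineq])
    finally show ?thesis by simp
  qed
  then have "(\<integral>x. norm (f (x + t) - f x) \<partial>lebesgue)
      \<le> (\<integral>x. norm (s (x + t) - f (x + t)) + norm (s (x + t) - s x) + norm (s x - f x) \<partial>lebesgue)"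
    using f s sf sf_shift s_shift integrable_lebesgue_translate_iff[of f t] by (intro integral_mono) auto
  also have "\<dots> = (\<integral>x. norm (s (x + t) - f (x + t)) \<partial>lebesgue) + (\<integral>x. norm (s (x + t) - s x) \<partial>lebesgue)
      + (\<integral>x. norm (s x - f x) \<partial>lebesgue)"
    using sf sf_shift s_shift by simp
  also have "(\<integral>x. norm (s (x + t) - f (x + t)) \<partial>lebesgue) = (\<integral>x. norm (s x - f x) \<partial>lebesgue)"
    using integral_lebesgue_translate[of "\<lambda>x. norm (s x - f x)" t] by simp
  finally show ?thesis by simp
qed

lemma L1_translate_add_le:
  fixes f g :: "real \<Rightarrow> 'a::euclidean_space"
  assumes f: "integrable lebesgue f" and g: "integrable lebesgue g"
  shows "(\<integral>x. norm (f (x + t) + g (x + t) - (f x + g x)) \<partial>lebesgue)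
    \<le> (\<integral>x. norm (f (x + t) - f x) \<partial>lebesgue) + (\<integral>x. norm (g (x + t) - g x) \<partial>lebesgue)"
proof -
  have diff_integrable: "integrable lebesgue (\<lambda>x. norm (h (x + t) - h x))"
    if "integrable lebesgue h" for h :: "real \<Rightarrow> 'a"
    using that integrable_lebesgue_translate_iff[of h t] by simp
  have "norm (f (x + t) + g (x + t) - (f x + g x)) \<le> norm (f (x + t) - f x) + norm (g (x + t) - g x)"
    for x by (metis add_diff_add norm_triangle_ineq)
  then have "(\<integral>x. norm (f (x + t) + g (x + t) - (f x + g x)) \<partial>lebesgue)
      \<le> (\<integral>x. norm (f (x + t) - f x) + norm (g (x + t) - g x) \<partial>lebesgue)"
    using f g diff_integrable[OF f] diff_integrable[OF g]
      integrable_lebesgue_translate_iff[of f t] integrable_lebesgue_translate_iff[of g t]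
    by (intro integral_mono) auto
  also have "\<dots> = (\<integral>x. norm (f (x + t) - f x) \<partial>lebesgue) + (\<integral>x. norm (g (x + t) - g x) \<partial>lebesgue)"
    using diff_integrable[OF f] diff_integrable[OF g] by (rule Bochner_Integration.integral_add)
  finally show ?thesis .
qed

lemma tendsto_L1_dominated:
  fixes f :: "'a \<Rightarrow> 'b::{banach, second_countable_topology}"
  assumes f: "integrable M f" and s: "\<And>i. s i \<in> borel_measurable M"
    and lim: "\<And>x. x \<in> space M \<Longrightarrow> (\<lambda>i. s i x) \<longlonglongrightarrow> f x"
    and bound: "\<And>i x. x \<in> space M \<Longrightarrow> norm (s i x) \<le> 2 * norm (f x)"
  shows "(\<lambda>i. \<integral>x. norm (s i x - f x) \<partial>M) \<longlonglongrightarrow> 0"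
proof -
  have "(\<lambda>i. \<integral>x. norm (s i x - f x) \<partial>M) \<longlonglongrightarrow> (\<integral>x. (0::real) \<partial>M)"
  proof (rule integral_dominated_convergence[where w="\<lambda>x. 3 * norm (f x)"])
    show "integrable M (\<lambda>x. 3 * norm (f x))" using f by simp
    show "(\<lambda>x. norm (s i x - f x)) \<in> borel_measurable M" for i
      using s borel_measurable_integrable[OF f] by simp
    show "AE x in M. (\<lambda>i. norm (s i x - f x)) \<longlonglongrightarrow> 0"
      using lim by (intro AE_I2) (simp add: tendsto_norm_zero_iff LIM_zero_iff)
    show "AE x in M. norm (norm (s i x - f x)) \<le> 3 * norm (f x)" for i
    proof (rule AE_I2)
      fix x assume "x \<in> space M"
      have "norm (s i x - f x) \<le> norm (s i x) + norm (f x)" by (rule norm_triangle_ineq4)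
      with bound[OF \<open>x \<in> space M\<close>, of i] show "norm (norm (s i x - f x)) \<le> 3 * norm (f x)" by simp
    qed
  qed simp
  then show ?thesis by simp
qed

lemma LIM_L1_translate:
  fixes g :: "real \<Rightarrow> 'a::euclidean_space"
  assumes "integrable lebesgue g"
  shows "(\<lambda>t. \<integral>x. norm (g (x + t) - g x) \<partial>lebesgue) \<midarrow>0\<rightarrow> 0"
  using assms
proof (induct rule: integrable_induct)
  case (base A c)
  then have "A \<in> lmeasurable" by (simp add: fmeasurableI)
  have "(\<integral>x. norm (indicat_real A (x + t) *\<^sub>R c - indicat_real A x *\<^sub>R c) \<partial>lebesgue)
      = norm c * (\<integral>x. \<bar>indicat_real A (x + t) - indicat_real A x\<bar> \<partial>lebesgue)" for t
    by (simp add: scaleR_diff_left[symmetric] mult.commute)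
  then show ?case
    using tendsto_mult_right_zero[OF LIM_L1_translate_indicator[OF \<open>A \<in> lmeasurable\<close>], of "norm c"]
    by simp
next
  case (add f g)
  show ?case
  proof (rule tendsto_sandwich[OF _ _ tendsto_const tendsto_add_zero[OF add(2,4)]])
    show "eventually (\<lambda>t. 0 \<le> (\<integral>x. norm (f (x + t) + g (x + t) - (f x + g x)) \<partial>lebesgue)) (at 0)"
      by simp
    show "eventually (\<lambda>t. (\<integral>x. norm (f (x + t) + g (x + t) - (f x + g x)) \<partial>lebesgue)
        \<le> (\<integral>x. norm (f (x + t) - f x) \<partial>lebesgue) + (\<integral>x. norm (g (x + t) - g x) \<partial>lebesgue)) (at 0)"
      using L1_translate_add_le[OF add(1,3)] by (rule always_eventually[OF allI])
  qed
next
  case (lim f s)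
  have approx: "(\<lambda>i. \<integral>x. norm (s i x - f x) \<partial>lebesgue) \<longlonglongrightarrow> 0"
    using lim by (intro tendsto_L1_dominated) (auto simp: borel_measurable_integrable)
  show ?case
    unfolding LIM_eq
  proof (intro allI impI)
    fix e :: real assume "e > 0"
    then obtain i where i: "(\<integral>x. norm (s i x - f x) \<partial>lebesgue) < e / 3"
      using order_tendstoD(2)[OF approx, of "e / 3"] by (auto simp: eventually_sequentially)
    obtain d where "d > 0" and d: "\<forall>t. t \<noteq> 0 \<and> norm (t - 0) < d \<longrightarrow>
        norm ((\<integral>x. norm (s i (x + t) - s i x) \<partial>lebesgue) - 0) < e / 3"
      using lim(2)[of i, unfolded LIM_eq, rule_format, of "e / 3"] \<open>e > 0\<close> by auto
    have "norm (\<integral>x. norm (f (x + t) - f x) \<partial>lebesgue) < e" if "t \<noteq> 0" "norm t < d" for t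
    proof -
      have "0 \<le> (\<integral>x. norm (f (x + t) - f x) \<partial>lebesgue)" by simp
      moreover have "(\<integral>x. norm (s i (x + t) - s i x) \<partial>lebesgue) < e / 3" using d that by simp
      ultimately show ?thesis using L1_translate_diff_le[OF lim(5) lim(1)[of i], of t] i by simp
    qed
    with \<open>d > 0\<close> show "\<exists>d>0. \<forall>t. t \<noteq> 0 \<and> norm (t - 0) < d \<longrightarrow>
        norm ((\<integral>x. norm (f (x + t) - f x) \<partial>lebesgue) - 0) < e"
      by auto
  qed
qed

section \<open>Bounded functionals on L1\<close>

lemma AE_le_if_nn_integral_indicator_le:
  assumes [measurable]: "f \<in> borel_measurable M" "g \<in> borel_measurable M"
    and fin: "integral\<^sup>N M g \<noteq> \<infinity>"
    and le: "\<And>A. A \<in> sets M \<Longrightarrow> (\<integral>\<^sup>+x. f x * indicator A x \<partial>M) \<le> (\<integral>\<^sup>+x. g x * indicator A x \<partial>M)"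
  shows "AE x in M. f x \<le> g x"
proof -
  let ?N = "{x\<in>space M. g x < f x}"
  have N: "?N \<in> sets M" by measurable
  have "(\<integral>\<^sup>+x. g x * indicator ?N x \<partial>M) \<le> integral\<^sup>N M g"
    by (intro nn_integral_mono) (auto split: split_indicator)
  then have g_fin: "(\<integral>\<^sup>+x. g x * indicator ?N x \<partial>M) \<noteq> \<infinity>" using fin by (auto simp: top_unique)
  have "(\<integral>\<^sup>+x. (f x - g x) * indicator ?N x \<partial>M)
      = (\<integral>\<^sup>+x. f x * indicator ?N x - g x * indicator ?N x \<partial>M)"
    by (auto intro!: nn_integral_cong simp: indicator_def)
  also have "\<dots> = (\<integral>\<^sup>+x. f x * indicator ?N x \<partial>M) - (\<integral>\<^sup>+x. g x * indicator ?N x \<partial>M)"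
  proof (rule nn_integral_diff)
    show "AE x in M. g x * indicator ?N x \<le> f x * indicator ?N x"
      by (rule AE_I2) (simp add: indicator_def less_imp_le)
  qed (use g_fin in simp_all)
  also have "\<dots> = 0"
  proof -
    have "(\<integral>\<^sup>+x. g x * indicator ?N x \<partial>M) < top"
      using g_fin by (simp add: less_top infinity_ennreal_def)
    with le[OF N] have "(\<integral>\<^sup>+x. f x * indicator ?N x \<partial>M) < top" by (rule le_less_trans)
    with le[OF N] show ?thesis by (simp add: diff_eq_0_iff_ennreal)
  qed
  finally have "AE x in M. (f x - g x) * indicator ?N x = 0"
    by (subst (asm) nn_integral_0_iff_AE) auto
  with AE_space show ?thesis
    by eventually_elim (auto simp: indicator_def ennreal_minus_eq_0 not_less split: if_splits)
qed

lemma tendsto_integral_mult_indicator_diff: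
  fixes w :: "'a \<Rightarrow> real"
  assumes w: "integrable M w" "\<And>x. 0 \<le> w x"
    and sets: "\<And>n. S n \<in> sets M" "U \<in> sets M"
    and exhaust: "\<And>x. x \<in> U \<Longrightarrow> eventually (\<lambda>n. x \<in> S n) sequentially"
  shows "(\<lambda>n. \<integral>x. w x * indicator (U - S n) x \<partial>M) \<longlonglongrightarrow> 0"
proof -
  have "(\<lambda>n. \<integral>x. w x * indicator (U - S n) x \<partial>M) \<longlonglongrightarrow> (\<integral>x. 0 \<partial>M)"
  proof (rule integral_dominated_convergence[where w=w])
    show "AE x in M. (\<lambda>n. w x * indicator (U - S n) x) \<longlonglongrightarrow> 0"
    proof (rule AE_I2)
      fix x
      have "eventually (\<lambda>n. x \<notin> U - S n) sequentially"
        using exhaust[of x] by (cases "x \<in> U") (auto elim: eventually_mono)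
      then show "(\<lambda>n. w x * indicator (U - S n) x) \<longlonglongrightarrow> 0"
        by (rule tendsto_eventually[OF eventually_mono]) simp
    qed
    show "AE x in M. norm (w x * indicator (U - S n) x) \<le> w x" for n
      using w(2) by (simp add: indicator_def)
  qed (use w sets in simp_all)
  then show ?thesis by simp
qed

lemma countably_additive_if_dominated:
  fixes \<nu> :: "'a set \<Rightarrow> real" and w :: "'a \<Rightarrow> real"
  assumes w: "integrable M w" "\<And>x. 0 \<le> w x"
    and add: "\<And>A B. A \<in> sets M \<Longrightarrow> B \<in> sets M \<Longrightarrow> A \<inter> B = {} \<Longrightarrow> \<nu> (A \<union> B) = \<nu> A + \<nu> B"
    and nonneg: "\<And>A. A \<in> sets M \<Longrightarrow> 0 \<le> \<nu> A"
    and dom: "\<And>A. A \<in> sets M \<Longrightarrow> \<nu> A \<le> (\<integral>x. w x * indicator A x \<partial>M)"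
  shows "countably_additive (sets M) (\<lambda>A. ennreal (\<nu> A))"
proof (rule countably_additiveI)
  fix F :: "nat \<Rightarrow> 'a set" assume F: "range F \<subseteq> sets M" "disjoint_family F"
  define S where "S n = (\<Union>i<n. F i)" for n
  define U where "U = (\<Union>i. F i)"
  have [measurable]: "F i \<in> sets M" "S n \<in> sets M" "U \<in> sets M" for i n
    using F(1) by (auto simp: S_def U_def)
  have partial_sums: "\<nu> (S n) = (\<Sum>i<n. \<nu> (F i))" for n
  proof (induct n)
    case 0
    show ?case using add[of "{}" "{}"] by (simp add: S_def)
  next
    case (Suc n)
    have "S n \<inter> F n = {}"
      using F(2) unfolding S_def disjoint_family_on_def by (auto, metis IntI empty_iff less_not_refl)
    moreover have "S (Suc n) = S n \<union> F n" by (auto simp: S_def lessThan_Suc)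
    ultimately show ?case using add[of "S n" "F n"] Suc by simp
  qed
  have "eventually (\<lambda>n. x \<in> S n) sequentially" if "x \<in> U" for x
  proof -
    from that obtain i where "x \<in> F i" by (auto simp: U_def)
    then show ?thesis by (auto simp: S_def eventually_sequentially intro!: exI[of _ "Suc i"])
  qed
  then have upper: "(\<lambda>n. \<integral>x. w x * indicator (U - S n) x \<partial>M) \<longlonglongrightarrow> 0"
    using w by (intro tendsto_integral_mult_indicator_diff) simp_all
  have "eventually (\<lambda>n. 0 \<le> \<nu> (U - S n)) sequentially"
    by (intro always_eventually allI nonneg) simp
  moreover have "eventually (\<lambda>n. \<nu> (U - S n) \<le> (\<integral>x. w x * indicator (U - S n) x \<partial>M)) sequentially"
    by (intro always_eventually allI dom) simp
  ultimately have tail: "(\<lambda>n. \<nu> (U - S n)) \<longlonglongrightarrow> 0"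
    using upper by (rule tendsto_sandwich[OF _ _ tendsto_const])
  have "\<nu> (S n) = \<nu> U - \<nu> (U - S n)" for n
  proof -
    have "S n \<subseteq> U" by (auto simp: S_def U_def)
    then show ?thesis using add[of "S n" "U - S n"] by (simp add: Un_absorb1)
  qed
  then have "(\<lambda>n. \<nu> (S n)) = (\<lambda>n. \<nu> U - \<nu> (U - S n))" by simp
  moreover have "(\<lambda>n. \<nu> U - \<nu> (U - S n)) \<longlonglongrightarrow> \<nu> U - 0" by (intro tendsto_diff tendsto_const tail)
  ultimately have "(\<lambda>n. \<nu> (S n)) \<longlonglongrightarrow> \<nu> U" by simp
  then have sums: "(\<lambda>i. \<nu> (F i)) sums \<nu> U" unfolding sums_def partial_sums[symmetric] .
  have "0 \<le> \<nu> (F i)" for i by (rule nonneg) simp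
  from suminf_ennreal_eq[OF this sums] show "(\<Sum>i. ennreal (\<nu> (F i))) = ennreal (\<nu> (\<Union>i. F i))"
    unfolding U_def .
qed

lemma dominated_additive_measure:
  fixes \<nu> :: "'a set \<Rightarrow> real" and w :: "'a \<Rightarrow> real"
  assumes w: "integrable M w" "\<And>x. 0 \<le> w x"
    and add: "\<And>A B. A \<in> sets M \<Longrightarrow> B \<in> sets M \<Longrightarrow> A \<inter> B = {} \<Longrightarrow> \<nu> (A \<union> B) = \<nu> A + \<nu> B"
    and nonneg: "\<And>A. A \<in> sets M \<Longrightarrow> 0 \<le> \<nu> A"
    and dom: "\<And>A. A \<in> sets M \<Longrightarrow> \<nu> A \<le> (\<integral>x. w x * indicator A x \<partial>M)"
  obtains N where "sets N = sets M" "\<And>A. A \<in> sets M \<Longrightarrow> emeasure N A = ennreal (\<nu> A)"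
    "absolutely_continuous M N"
proof -
  define N where "N = measure_of (space M) (sets M) (\<lambda>A. ennreal (\<nu> A))"
  have sets_N: "sets N = sets M" unfolding N_def by (rule sets.sets_measure_of_eq)
  have emeasure_N: "emeasure N A = ennreal (\<nu> A)" if "A \<in> sets M" for A
    unfolding N_def
  proof (rule emeasure_measure_of_sigma[OF sets.sigma_algebra_axioms _ _ that])
    show "positive (sets M) (\<lambda>A. ennreal (\<nu> A))"
      using add[of "{}" "{}"] by (simp add: positive_def)
    show "countably_additive (sets M) (\<lambda>A. ennreal (\<nu> A))"
      by (rule countably_additive_if_dominated[OF w add nonneg dom])
  qed
  have "absolutely_continuous M N"
    unfolding absolutely_continuous_def
  proof
    fix A assume A: "A \<in> null_sets M"
    have "(\<integral>x. w x * indicator A x \<partial>M) = 0"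
      by (rule integral_eq_zero_AE) (use AE_not_in[OF A] in \<open>auto simp: indicator_def\<close>)
    then have "\<nu> A = 0" using dom[of A] nonneg[of A] A by auto
    then show "A \<in> null_sets N" using emeasure_N A by (auto simp: null_sets_def sets_N)
  qed
  with sets_N emeasure_N that show ?thesis by blast
qed

lemma (in sigma_finite_measure) additive_dominated_density:
  fixes \<nu> :: "'a set \<Rightarrow> real" and w :: "'a \<Rightarrow> real"
  assumes w: "integrable M w" "\<And>x. 0 \<le> w x"
    and add: "\<And>A B. A \<in> sets M \<Longrightarrow> B \<in> sets M \<Longrightarrow> A \<inter> B = {} \<Longrightarrow> \<nu> (A \<union> B) = \<nu> A + \<nu> B"
    and nonneg: "\<And>A. A \<in> sets M \<Longrightarrow> 0 \<le> \<nu> A"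
    and dom: "\<And>A. A \<in> sets M \<Longrightarrow> \<nu> A \<le> (\<integral>x. w x * indicator A x \<partial>M)"
  obtains d where "d \<in> borel_measurable M" "AE x in M. 0 \<le> d x \<and> d x \<le> w x"
    "\<And>A. A \<in> sets M \<Longrightarrow> integrable M (\<lambda>x. d x * indicator A x)"
    "\<And>A. A \<in> sets M \<Longrightarrow> \<nu> A = (\<integral>x. d x * indicator A x \<partial>M)"
proof -
  have w_indicator: "integrable M (\<lambda>x. w x * indicator A x)" if "A \<in> sets M" for A
    using integrable_mult_indicator[OF that w(1)] by (simp add: mult.commute)
  obtain N where sets_N: "sets N = sets M" and emeasure_N: "\<And>A. A \<in> sets M \<Longrightarrow> emeasure N A = ennreal (\<nu> A)"
    and "absolutely_continuous M N"
    using dominated_additive_measure[OF w add nonneg dom] by blast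
  then obtain D where D [measurable]: "D \<in> borel_measurable M" and "density M D = N"
    using Radon_Nikodym sets_N by metis
  then have \<nu>_D: "ennreal (\<nu> A) = (\<integral>\<^sup>+x. D x * indicator A x \<partial>M)" if "A \<in> sets M" for A
    using emeasure_N[OF that] emeasure_density[OF D that] by simp
  have "AE x in M. D x \<le> ennreal (w x)"
  proof (rule AE_le_if_nn_integral_indicator_le)
    show "integral\<^sup>N M (\<lambda>x. ennreal (w x)) \<noteq> \<infinity>"
      using nn_integral_eq_integral[OF w(1)] w(2) by simp
    fix A assume A: "A \<in> sets M"
    have "(\<integral>\<^sup>+x. D x * indicator A x \<partial>M) \<le> ennreal (\<integral>x. w x * indicator A x \<partial>M)"
      using \<nu>_D[OF A] dom[OF A] by (metis ennreal_leI)
    also have "\<dots> = (\<integral>\<^sup>+x. ennreal (w x * indicator A x) \<partial>M)"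
      using w(2) by (intro nn_integral_eq_integral[symmetric] w_indicator[OF A]) simp
    also have "\<dots> = (\<integral>\<^sup>+x. ennreal (w x) * indicator A x \<partial>M)"
      by (intro nn_integral_cong) (simp add: indicator_def)
    finally show "(\<integral>\<^sup>+x. D x * indicator A x \<partial>M) \<le> (\<integral>\<^sup>+x. ennreal (w x) * indicator A x \<partial>M)" .
  qed (use w(1) in auto)
  then have AE_D: "AE x in M. D x = ennreal (enn2real (D x)) \<and> 0 \<le> enn2real (D x) \<and> enn2real (D x) \<le> w x"
    by eventually_elim (auto simp: w(2) enn2real_leI less_top[symmetric] intro: ennreal_enn2real
        dest: order.strict_trans1[OF _ ennreal_less_top])
  define d where "d x = enn2real (D x)" for x
  have d [measurable]: "d \<in> borel_measurable M" unfolding d_def by measurable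
  have d_indicator: "integrable M (\<lambda>x. d x * indicator A x)" if A: "A \<in> sets M" for A
  proof (rule Bochner_Integration.integrable_bound[OF w_indicator[OF A]])
    show "(\<lambda>x. d x * indicator A x) \<in> borel_measurable M" using A by measurable
    show "AE x in M. norm (d x * indicator A x) \<le> norm (w x * indicator A x)"
      using AE_D by eventually_elim (auto simp: d_def indicator_def)
  qed
  have "\<nu> A = (\<integral>x. d x * indicator A x \<partial>M)" if A: "A \<in> sets M" for A
  proof -
    have "ennreal (\<nu> A) = (\<integral>\<^sup>+x. ennreal (d x * indicator A x) \<partial>M)"
      unfolding \<nu>_D[OF A] using AE_D
      by (intro nn_integral_cong_AE) (auto simp: d_def indicator_def elim!: eventually_mono)
    also have "\<dots> = ennreal (\<integral>x. d x * indicator A x \<partial>M)"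
      by (rule nn_integral_eq_integral[OF d_indicator[OF A]]) (use AE_D in \<open>auto simp: d_def elim!: eventually_mono\<close>)
    finally show ?thesis
      using nonneg[OF A] AE_D by (subst (asm) ennreal_inj) (auto simp: d_def intro!: integral_nonneg_AE
          elim!: eventually_mono)
  qed
  moreover have "AE x in M. 0 \<le> d x \<and> d x \<le> w x"
    using AE_D by eventually_elim (simp add: d_def)
  ultimately show ?thesis using that d d_indicator by blast
qed

(* A positive integrable weight: the measure with this density is finite, which makes
   Radon-Nikodym applicable to functionals on L1(R). *)
definition weight :: "real \<Rightarrow> real" where
  "weight x = exp (- \<bar>x\<bar>)"
lemma borel_measurable_weight [measurable]: "weight \<in> borel_measurable lebesgue"
  unfolding weight_def[abs_def] by measurable

lemma integrable_weight: "integrable lebesgue weight"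
proof -
  have "integrable lebesgue (\<lambda>x::real. indicat_real {0..} x *\<^sub>R exp (- 1 * x))"
    by (intro nonnegative_absolutely_integrable_1 [unfolded set_integrable_def] integrable_on_exp_minus_to_infinity) auto
  then have i: "integrable lebesgue (\<lambda>x::real. indicat_real {0..} x * exp (- x))" by simp
  then have "integrable lebesgue (\<lambda>x::real. indicat_real {0..} (- x) * exp (- (- x)))"
    using lebesgue_integrable_real_affine_iff[of "-1" "\<lambda>x. indicat_real {0..} x * exp (- x)" 0] by simp
  with i have "integrable lebesgue (\<lambda>x::real. indicat_real {0..} x * exp (- x) + indicat_real {0..} (- x) * exp x)"
    by simp
  then show ?thesis
    by (rule Bochner_Integration.integrable_bound) (auto simp: weight_def indicator_def)
qed

lemma weight_pos: "0 < weight x"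
  by (simp add: weight_def)

lemma integrable_weight_indicator: "A \<in> sets lebesgue \<Longrightarrow> integrable lebesgue (\<lambda>x. weight x * indicator A x)"
  using integrable_mult_indicator[OF _ integrable_weight, of A] by (simp add: mult.commute)

lemma sigma_finite_lebesgue: "sigma_finite_measure (lebesgue :: real measure)"
  unfolding sigma_finite_measure_def
proof (intro exI[of _ "range (\<lambda>n::nat. {- real n..real n})"] conjI)
  show "\<Union> (range (\<lambda>n::nat. {- real n..real n})) = space lebesgue"
  proof auto
    show "\<exists>n. - real n \<le> x \<and> x \<le> real n" for x :: real
      by (rule exI[of _ "nat \<lceil>\<bar>x\<bar>\<rceil>"]) linarith
  qed
qed auto

lemma signed_additive_density:
  fixes l :: "real set \<Rightarrow> real" and C :: real
  assumes C: "0 \<le> C"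
    and bound: "\<And>A. A \<in> sets lebesgue \<Longrightarrow> \<bar>l A\<bar> \<le> C * (\<integral>x. weight x * indicator A x \<partial>lebesgue)"
    and add: "\<And>A B. A \<in> sets lebesgue \<Longrightarrow> B \<in> sets lebesgue \<Longrightarrow> A \<inter> B = {} \<Longrightarrow> l (A \<union> B) = l A + l B"
  obtains h where "h \<in> borel_measurable lebesgue" "AE x in lebesgue. \<bar>h x\<bar> \<le> C"
    "\<And>A. A \<in> sets lebesgue \<Longrightarrow> l A = (\<integral>x. h x * weight x * indicator A x \<partial>lebesgue)"
proof -
  define W where "W A = (\<integral>x. weight x * indicator A x \<partial>lebesgue)" for A :: "real set"
  have W_add: "W (A \<union> B) = W A + W B" if "A \<in> sets lebesgue" "B \<in> sets lebesgue" "A \<inter> B = {}" for A B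
  proof -
    have "W (A \<union> B) = (\<integral>x. weight x * indicator A x + weight x * indicator B x \<partial>lebesgue)"
      unfolding W_def using that(3) by (intro Bochner_Integration.integral_cong) (auto simp: indicator_def)
    then show ?thesis
      using integrable_weight_indicator[OF that(1)] integrable_weight_indicator[OF that(2)] by (simp add: W_def)
  qed
  \<comment> \<open>shifting by the dominating measure makes the set function nonnegative\<close>
  define \<nu> where "\<nu> A = l A + C * W A" for A
  obtain d where d [measurable]: "d \<in> borel_measurable lebesgue"
    and d_bound: "AE x in lebesgue. 0 \<le> d x \<and> d x \<le> 2 * C * weight x"
    and d_indicator: "\<And>A. A \<in> sets lebesgue \<Longrightarrow> integrable lebesgue (\<lambda>x. d x * indicator A x)"
    and \<nu>_d: "\<And>A. A \<in> sets lebesgue \<Longrightarrow> \<nu> A = (\<integral>x. d x * indicator A x \<partial>lebesgue)"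
  proof (rule sigma_finite_measure.additive_dominated_density[OF sigma_finite_lebesgue])
    show "integrable lebesgue (\<lambda>x. 2 * C * weight x)" using integrable_weight by simp
    show "0 \<le> 2 * C * weight x" for x using C weight_pos[of x] by simp
    show "\<nu> (A \<union> B) = \<nu> A + \<nu> B" if "A \<in> sets lebesgue" "B \<in> sets lebesgue" "A \<inter> B = {}" for A B
      using add[OF that] W_add[OF that] by (simp add: \<nu>_def algebra_simps)
    show "0 \<le> \<nu> A" if "A \<in> sets lebesgue" for A
      using bound[OF that] by (simp add: \<nu>_def W_def abs_le_iff)
    show "\<nu> A \<le> (\<integral>x. 2 * C * weight x * indicator A x \<partial>lebesgue)" if "A \<in> sets lebesgue" for A
      using bound[OF that] by (simp add: \<nu>_def W_def abs_le_iff mult.assoc)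
  qed blast
  define h where "h x = d x / weight x - C" for x
  show ?thesis
  proof
    show "h \<in> borel_measurable lebesgue" unfolding h_def by measurable
    show "AE x in lebesgue. \<bar>h x\<bar> \<le> C"
      using d_bound by eventually_elim
        (use weight_pos in \<open>auto simp: h_def abs_le_iff divide_le_eq le_divide_eq\<close>)
    fix A :: "real set" assume A: "A \<in> sets lebesgue"
    have "l A = \<nu> A - C * W A" by (simp add: \<nu>_def)
    also have "\<dots> = (\<integral>x. d x * indicator A x \<partial>lebesgue) - (\<integral>x. C * (weight x * indicator A x) \<partial>lebesgue)"
      unfolding \<nu>_d[OF A] W_def integral_mult_right_zero ..
    also have "\<dots> = (\<integral>x. d x * indicator A x - C * (weight x * indicator A x) \<partial>lebesgue)"
      using d_indicator[OF A] integrable_weight_indicator[OF A]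
      by (intro Bochner_Integration.integral_diff[symmetric]) simp_all
    also have "\<dots> = (\<integral>x. h x * weight x * indicator A x \<partial>lebesgue)"
      using weight_pos[THEN less_imp_neq] by (intro Bochner_Integration.integral_cong)
        (auto simp: h_def field_simps)
    finally show "l A = (\<integral>x. h x * weight x * indicator A x \<partial>lebesgue)" .
  qed
qed

lemma complex_additive_density:
  fixes l :: "real set \<Rightarrow> complex" and C :: real
  assumes C: "0 \<le> C"
    and bound: "\<And>A. A \<in> sets lebesgue \<Longrightarrow> norm (l A) \<le> C * (\<integral>x. weight x * indicator A x \<partial>lebesgue)"
    and add: "\<And>A B. A \<in> sets lebesgue \<Longrightarrow> B \<in> sets lebesgue \<Longrightarrow> A \<inter> B = {} \<Longrightarrow> l (A \<union> B) = l A + l B"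
  obtains h where "h \<in> borel_measurable lebesgue" "AE x in lebesgue. norm (h x) \<le> 2 * C"
    "\<And>A. A \<in> sets lebesgue \<Longrightarrow> l A = (\<integral>x. h x * of_real (weight x * indicator A x) \<partial>lebesgue)"
proof -
  obtain hR where hR: "hR \<in> borel_measurable lebesgue" "AE x in lebesgue. \<bar>hR x\<bar> \<le> C"
    "\<And>A. A \<in> sets lebesgue \<Longrightarrow> Re (l A) = (\<integral>x. hR x * weight x * indicator A x \<partial>lebesgue)"
  proof (rule signed_additive_density[OF C])
    show "\<bar>Re (l A)\<bar> \<le> C * (\<integral>x. weight x * indicator A x \<partial>lebesgue)" if "A \<in> sets lebesgue" for A
      using abs_Re_le_cmod[of "l A"] bound[OF that] by linarith
  qed (use add in simp_all)
  obtain hI where hI: "hI \<in> borel_measurable lebesgue" "AE x in lebesgue. \<bar>hI x\<bar> \<le> C"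
    "\<And>A. A \<in> sets lebesgue \<Longrightarrow> Im (l A) = (\<integral>x. hI x * weight x * indicator A x \<partial>lebesgue)"
  proof (rule signed_additive_density[OF C])
    show "\<bar>Im (l A)\<bar> \<le> C * (\<integral>x. weight x * indicator A x \<partial>lebesgue)" if "A \<in> sets lebesgue" for A
      using abs_Im_le_cmod[of "l A"] bound[OF that] by linarith
  qed (use add in simp_all)
  define h where "h x = complex_of_real (hR x) + \<i> * complex_of_real (hI x)" for x
  show ?thesis
  proof
    show "h \<in> borel_measurable lebesgue" unfolding h_def using hR(1) hI(1) by measurable
    show "AE x in lebesgue. norm (h x) \<le> 2 * C"
      using hR(2) hI(2)
    proof eventually_elim
      case (elim x)
      have "norm (h x) \<le> norm (complex_of_real (hR x)) + norm (\<i> * complex_of_real (hI x))"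
        unfolding h_def by (rule norm_triangle_ineq)
      with elim show ?case by (simp add: norm_mult)
    qed
    fix A :: "real set" assume A: "A \<in> sets lebesgue"
    have part_integrable: "integrable lebesgue (\<lambda>x. r x * weight x * indicator A x)"
      if "r \<in> borel_measurable lebesgue" "AE x in lebesgue. \<bar>r x\<bar> \<le> C" for r
    proof (rule Bochner_Integration.integrable_bound)
      show "integrable lebesgue (\<lambda>x. C * (weight x * indicator A x))"
        using integrable_weight_indicator[OF A] by simp
      show "(\<lambda>x. r x * weight x * indicator A x) \<in> borel_measurable lebesgue" using that A by measurable
      show "AE x in lebesgue. norm (r x * weight x * indicator A x) \<le> norm (C * (weight x * indicator A x))"
        using that(2) by eventually_elim
          (use weight_pos[THEN less_imp_le] C in \<open>auto simp: indicator_def abs_mult intro!: mult_right_mono\<close>)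
    qed
    have re: "integrable lebesgue (\<lambda>x. complex_of_real (hR x * weight x * indicator A x))"
      by (rule integrable_of_real[OF part_integrable[OF hR(1,2)]])
    have im: "integrable lebesgue (\<lambda>x. \<i> * complex_of_real (hI x * weight x * indicator A x))"
      by (rule integrable_mult_right[OF integrable_of_real[OF part_integrable[OF hI(1,2)]]])
    have "(\<integral>x. h x * of_real (weight x * indicator A x) \<partial>lebesgue) = (\<integral>x. complex_of_real (hR x * weight x * indicator A x)
        + \<i> * complex_of_real (hI x * weight x * indicator A x) \<partial>lebesgue)"
      by (rule Bochner_Integration.integral_cong) (auto simp: h_def algebra_simps)
    also have "\<dots> = complex_of_real (Re (l A)) + \<i> * complex_of_real (Im (l A))"
      unfolding Bochner_Integration.integral_add[OF re im] integral_mult_right_zero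
        integral_complex_of_real hR(3)[OF A] hI(3)[OF A] ..
    finally show "l A = (\<integral>x. h x * of_real (weight x * indicator A x) \<partial>lebesgue)"
      by (simp add: complex_eq[symmetric])
  qed
qed

lemma integrable_bounded_mult:
  fixes g h :: "'a \<Rightarrow> complex"
  assumes "integrable M g" "h \<in> borel_measurable M" "AE x in M. norm (h x) \<le> C"
  shows "integrable M (\<lambda>x. h x * g x)"
proof (rule Bochner_Integration.integrable_bound[OF integrable_mult_right[OF assms(1), of "of_real C"]])
  show "(\<lambda>x. h x * g x) \<in> borel_measurable M"
    using assms(1,2) by (simp add: borel_measurable_integrable)
  show "AE x in M. norm (h x * g x) \<le> norm (of_real C * g x)"
    using assms(3)
  proof eventually_elim
    case (elim x)
    then have "C \<ge> 0" using norm_ge_zero order_trans by blast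
    with elim show ?case by (simp add: norm_mult mult_right_mono)
  qed
qed

lemma norm_integral_bounded_mult_le:
  fixes g h :: "'a \<Rightarrow> complex"
  assumes g: "integrable M g" and h: "h \<in> borel_measurable M" "AE x in M. norm (h x) \<le> C"
  shows "norm (\<integral>x. h x * g x \<partial>M) \<le> C * (\<integral>x. norm (g x) \<partial>M)"
proof -
  have "norm (\<integral>x. h x * g x \<partial>M) \<le> (\<integral>x. norm (h x * g x) \<partial>M)"
    by (rule integral_norm_bound)
  also have "\<dots> \<le> (\<integral>x. C * norm (g x) \<partial>M)"
    using integrable_norm[OF integrable_bounded_mult[OF g h]] g h(2)
    by (intro integral_mono_AE) (auto simp: norm_mult intro!: mult_right_mono elim!: eventually_mono)
  finally show ?thesis by simp
qed

lemma bounded_additive_L1_continuous: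
  fixes \<Lambda> :: "('a \<Rightarrow> 'b::{banach, second_countable_topology}) \<Rightarrow> 'c::real_normed_vector"
  assumes add: "\<And>g1 g2. integrable M g1 \<Longrightarrow> integrable M g2 \<Longrightarrow> \<Lambda> (\<lambda>x. g1 x + g2 x) = \<Lambda> g1 + \<Lambda> g2"
    and bounded: "\<And>g. integrable M g \<Longrightarrow> norm (\<Lambda> g) \<le> C * (\<integral>x. norm (g x) \<partial>M)"
    and a: "\<And>i. integrable M (a i)" and b: "integrable M b"
    and L1_lim: "(\<lambda>i. \<integral>x. norm (a i x - b x) \<partial>M) \<longlonglongrightarrow> 0"
  shows "(\<lambda>i. \<Lambda> (a i)) \<longlonglongrightarrow> \<Lambda> b"
proof -
  have diff: "\<Lambda> (a i) - \<Lambda> b = \<Lambda> (\<lambda>x. a i x - b x)" for i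
    using add[of "\<lambda>x. a i x - b x" b] a b by simp
  have "(\<lambda>i. \<Lambda> (a i) - \<Lambda> b) \<longlonglongrightarrow> 0"
  proof (rule Lim_null_comparison)
    show "eventually (\<lambda>i. norm (\<Lambda> (a i) - \<Lambda> b) \<le> C * (\<integral>x. norm (a i x - b x) \<partial>M)) sequentially"
      unfolding diff using a b by (intro always_eventually allI bounded) simp
    show "(\<lambda>i. C * (\<integral>x. norm (a i x - b x) \<partial>M)) \<longlonglongrightarrow> 0"
      using tendsto_mult_right_zero[OF L1_lim] by simp
  qed
  then show ?thesis by (simp add: LIM_zero_iff)
qed

lemma integrable_weight_density_iff:
  fixes \<phi> :: "real \<Rightarrow> complex"
  shows "integrable (density lebesgue (\<lambda>x. ennreal (weight x))) \<phi> \<longleftrightarrow>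
    integrable lebesgue (\<lambda>x. weight x *\<^sub>R \<phi> x)"
proof (cases "\<phi> \<in> borel_measurable lebesgue")
  case True
  then show ?thesis
    by (rule integrable_density[OF _ borel_measurable_weight]) (simp add: less_imp_le weight_pos)
next
  case False
  have "\<not> integrable lebesgue (\<lambda>x. weight x *\<^sub>R \<phi> x)"
  proof
    assume "integrable lebesgue (\<lambda>x. weight x *\<^sub>R \<phi> x)"
    then have "(\<lambda>x. inverse (weight x) *\<^sub>R (weight x *\<^sub>R \<phi> x)) \<in> borel_measurable lebesgue"
      using borel_measurable_integrable by measurable
    with False show False using weight_pos[THEN less_imp_neq] by simp
  qed
  with False show ?thesis
    by (auto dest: borel_measurable_integrable simp: measurable_density_eq1)
qed

lemma L1_functionals_eq_if_eq_on_weighted_indicators: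
  fixes \<Phi> \<Psi> :: "(real \<Rightarrow> complex) \<Rightarrow> complex"
  assumes add: "\<And>\<Lambda> g1 g2. \<Lambda> \<in> {\<Phi>, \<Psi>} \<Longrightarrow> integrable lebesgue g1 \<Longrightarrow> integrable lebesgue g2 \<Longrightarrow>
      \<Lambda> (\<lambda>x. g1 x + g2 x) = \<Lambda> g1 + \<Lambda> g2"
    and mult: "\<And>\<Lambda> c g. \<Lambda> \<in> {\<Phi>, \<Psi>} \<Longrightarrow> integrable lebesgue g \<Longrightarrow> \<Lambda> (\<lambda>x. c * g x) = c * \<Lambda> g"
    and bounded: "\<And>\<Lambda> g. \<Lambda> \<in> {\<Phi>, \<Psi>} \<Longrightarrow> integrable lebesgue g \<Longrightarrow>
      norm (\<Lambda> g) \<le> C * (\<integral>x. norm (g x) \<partial>lebesgue)"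
    and indicators: "\<And>A. A \<in> sets lebesgue \<Longrightarrow>
      \<Phi> (\<lambda>x. of_real (weight x * indicator A x)) = \<Psi> (\<lambda>x. of_real (weight x * indicator A x))"
    and g: "integrable lebesgue g"
  shows "\<Phi> g = \<Psi> g"
proof -
  \<comment> \<open>Induction over the functions integrable for the finite measure with density weight;
     its indicator functions correspond to the weighted indicators.\<close>
  define M where "M = density lebesgue (\<lambda>x. ennreal (weight x))"
  note weighted_integrable = integrable_weight_density_iff[folded M_def, THEN iffD1]
  have "\<Phi> (\<lambda>x. weight x *\<^sub>R \<phi> x) = \<Psi> (\<lambda>x. weight x *\<^sub>R \<phi> x)" if "integrable M \<phi>" for \<phi>
    using that
  proof (induct rule: integrable_induct)
    case (base A c)
    then have A: "A \<in> sets lebesgue" by (simp add: M_def)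
    have "(\<lambda>x. weight x *\<^sub>R (indicator A x *\<^sub>R c)) = (\<lambda>x. c * of_real (weight x * indicator A x))"
      by (simp add: fun_eq_iff scaleR_conv_of_real)
    moreover have "integrable lebesgue (\<lambda>x. complex_of_real (weight x * indicator A x))"
      by (rule integrable_of_real[OF integrable_weight_indicator[OF A]])
    ultimately show ?case
      using mult[of \<Phi> _ c] mult[of \<Psi> _ c] indicators[OF A] by simp
  next
    case (add f g)
    then show ?case
      using weighted_integrable[OF add(1)] weighted_integrable[OF add(3)]
        assms(1)[of \<Phi> "\<lambda>x. weight x *\<^sub>R f x" "\<lambda>x. weight x *\<^sub>R g x"]
        assms(1)[of \<Psi> "\<lambda>x. weight x *\<^sub>R f x" "\<lambda>x. weight x *\<^sub>R g x"]
      by (simp add: scaleR_add_right)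
  next
    case (lim f s)
    have "(\<lambda>i. \<integral>x. norm (weight x *\<^sub>R s i x - weight x *\<^sub>R f x) \<partial>lebesgue) \<longlonglongrightarrow> 0"
    proof (rule tendsto_L1_dominated[OF weighted_integrable[OF lim(5)]])
      show "(\<lambda>x. weight x *\<^sub>R s i x) \<in> borel_measurable lebesgue" for i
        using borel_measurable_integrable[OF weighted_integrable[OF lim(1)]] .
      show "(\<lambda>i. weight x *\<^sub>R s i x) \<longlonglongrightarrow> weight x *\<^sub>R f x" for x
        using lim(3)[of x] by (simp add: M_def tendsto_scaleR)
      show "norm (weight x *\<^sub>R s i x) \<le> 2 * norm (weight x *\<^sub>R f x)" for i x
        using lim(4)[of x i] weight_pos[of x] by (simp add: M_def)
    qed
    note L1_lim = bounded_additive_L1_continuous[OF _ _ weighted_integrable[OF lim(1)]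
        weighted_integrable[OF lim(5)] this]
    have "\<Phi> \<in> {\<Phi>, \<Psi>}" "\<Psi> \<in> {\<Phi>, \<Psi>}" by simp_all
    from L1_lim[OF add[OF this(1)] bounded[OF this(1)]] L1_lim[OF add[OF this(2)] bounded[OF this(2)]]
    show ?case unfolding lim(2) by (rule LIMSEQ_unique)
  qed
  moreover have unweight: "(\<lambda>x. weight x *\<^sub>R (g x /\<^sub>R weight x)) = g"
    using weight_pos[THEN less_imp_neq] by (simp add: fun_eq_iff)
  moreover have "integrable M (\<lambda>x. g x /\<^sub>R weight x)"
    unfolding M_def integrable_weight_density_iff unweight by (rule g)
  ultimately show ?thesis by metis
qed

lemma L1_dual_representation:
  fixes \<Lambda> :: "(real \<Rightarrow> complex) \<Rightarrow> complex" and C :: real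
  assumes C: "0 \<le> C"
    and add: "\<And>g1 g2. integrable lebesgue g1 \<Longrightarrow> integrable lebesgue g2 \<Longrightarrow> \<Lambda> (\<lambda>x. g1 x + g2 x) = \<Lambda> g1 + \<Lambda> g2"
    and mult: "\<And>c g. integrable lebesgue g \<Longrightarrow> \<Lambda> (\<lambda>x. c * g x) = c * \<Lambda> g"
    and bounded: "\<And>g. integrable lebesgue g \<Longrightarrow> norm (\<Lambda> g) \<le> C * (\<integral>x. norm (g x) \<partial>lebesgue)"
  obtains h where "h \<in> borel_measurable lebesgue" "AE x in lebesgue. norm (h x) \<le> 2 * C"
    "\<And>g. integrable lebesgue g \<Longrightarrow> \<Lambda> g = (\<integral>x. h x * g x \<partial>lebesgue)"
proof -
  let ?e = "\<lambda>A x. complex_of_real (weight x * indicator A x)"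
  have e_integrable: "integrable lebesgue (?e A)" if "A \<in> sets lebesgue" for A
    by (rule integrable_of_real[OF integrable_weight_indicator[OF that]])
  obtain h where h: "h \<in> borel_measurable lebesgue" and h_bound: "AE x in lebesgue. norm (h x) \<le> 2 * C"
    and on_indicators: "\<And>A. A \<in> sets lebesgue \<Longrightarrow> \<Lambda> (?e A) = (\<integral>x. h x * ?e A x \<partial>lebesgue)"
  proof (rule complex_additive_density[OF C])
    show "norm (\<Lambda> (?e A)) \<le> C * (\<integral>x. weight x * indicator A x \<partial>lebesgue)" if "A \<in> sets lebesgue" for A
      using bounded[OF e_integrable[OF that]] weight_pos[THEN less_imp_le]
      by (simp add: norm_mult abs_mult)
    show "\<Lambda> (?e (A \<union> B)) = \<Lambda> (?e A) + \<Lambda> (?e B)"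
      if "A \<in> sets lebesgue" "B \<in> sets lebesgue" "A \<inter> B = {}" for A B
    proof -
      have "?e (A \<union> B) = (\<lambda>x. ?e A x + ?e B x)"
        using that(3) by (auto simp: fun_eq_iff indicator_def)
      then show ?thesis using add[OF e_integrable[OF that(1)] e_integrable[OF that(2)]] by simp
    qed
  qed blast
  note h_integrable = integrable_bounded_mult[OF _ h h_bound]
  note h_bounded = norm_integral_bounded_mult_le[OF _ h h_bound]
  have "\<Lambda> g = (\<integral>x. h x * g x \<partial>lebesgue)" if "integrable lebesgue g" for g
  proof (rule L1_functionals_eq_if_eq_on_weighted_indicators[where \<Phi> = \<Lambda>
        and \<Psi> = "\<lambda>g. \<integral>x. h x * g x \<partial>lebesgue" and C = "2 * C"])
    show "\<Lambda>' (\<lambda>x. g1 x + g2 x) = \<Lambda>' g1 + \<Lambda>' g2"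
      if "\<Lambda>' \<in> {\<Lambda>, \<lambda>g. \<integral>x. h x * g x \<partial>lebesgue}" "integrable lebesgue g1" "integrable lebesgue g2"
      for \<Lambda>' g1 g2
      using that add h_integrable by (auto simp: distrib_left)
    show "\<Lambda>' (\<lambda>x. c * g x) = c * \<Lambda>' g"
      if "\<Lambda>' \<in> {\<Lambda>, \<lambda>g. \<integral>x. h x * g x \<partial>lebesgue}" "integrable lebesgue g" for \<Lambda>' c g
      using that mult by (auto simp: mult.left_commute)
    show "norm (\<Lambda>' g) \<le> 2 * C * (\<integral>x. norm (g x) \<partial>lebesgue)"
      if "\<Lambda>' \<in> {\<Lambda>, \<lambda>g. \<integral>x. h x * g x \<partial>lebesgue}" "integrable lebesgue g" for \<Lambda>' g
      using that bounded[of g] h_bounded[of g] C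
      by (auto intro: order_trans[OF _ mult_right_mono[of C "2 * C"]])
  qed (use on_indicators that in simp_all)
  with h h_bound that show ?thesis by blast
qed

section \<open>Weak-* limits of translates\<close>

definition zero_ext :: "(real \<Rightarrow> complex) \<Rightarrow> real \<Rightarrow> complex" where
  "zero_ext f x = indicator {0..} x *\<^sub>R f x"

lemma zero_ext_simps [simp]: "0 \<le> x \<Longrightarrow> zero_ext f x = f x" "x < 0 \<Longrightarrow> zero_ext f x = 0"
  by (auto simp: zero_ext_def)

lemma L1_Rp_iff: "g \<in> L1_Rp \<longleftrightarrow> integrable lebesgue (zero_ext g)"
  by (simp add: L1_Rp_def set_integrable_def zero_ext_def[abs_def])

lemma Linf_Rp_measurable: "f \<in> Linf_Rp \<Longrightarrow> zero_ext f \<in> borel_measurable lebesgue"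
  by (simp add: Linf_Rp_def set_borel_measurable_def zero_ext_def[abs_def])

lemma Linf_Rp_bound:
  assumes "f \<in> Linf_Rp"
  obtains C where "C > 0" "AE x in lebesgue. norm (zero_ext f x) \<le> C"
proof -
  obtain C where C: "AE x in lebesgue. x \<ge> 0 \<longrightarrow> norm (f x) \<le> C"
    using assms by (auto simp: Linf_Rp_def)
  then have "AE x in lebesgue. norm (zero_ext f x) \<le> max C 1"
    by eventually_elim (auto simp: zero_ext_def indicator_def)
  then show ?thesis using that[of "max C 1"] by auto
qed

lemma Linf_Rp_const: "(\<lambda>_. \<alpha>) \<in> Linf_Rp"
  unfolding Linf_Rp_def set_borel_measurable_def
  by (auto intro!: exI[of _ "norm \<alpha>"] borel_measurable_scaleR borel_measurable_indicator)

(* Unlike pair_shift, this is defined for every integrable g on the whole line, so that its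
   limits are functionals on L1(R). *)
definition shifted_pairing :: "(real \<Rightarrow> complex) \<Rightarrow> (real \<Rightarrow> complex) \<Rightarrow> real \<Rightarrow> complex" where
  "shifted_pairing f g s = (\<integral>x. zero_ext f (x + s) * g x \<partial>lebesgue)"

lemma pair_shift_eq_shifted_pairing:
  "0 \<le> s \<Longrightarrow> pair_shift f g s = shifted_pairing f (zero_ext g) s"
  unfolding pair_shift_def shifted_pairing_def set_lebesgue_integral_def
  by (rule Bochner_Integration.integral_cong) (auto simp: zero_ext_def indicator_def)

lemma integrable_shifted_pairing:
  assumes "f \<in> Linf_Rp" "integrable lebesgue g"
  shows "integrable lebesgue (\<lambda>x. zero_ext f (x + s) * g x)"
proof -
  obtain C where "AE x in lebesgue. norm (zero_ext f x) \<le> C" using Linf_Rp_bound[OF assms(1)] .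
  then show ?thesis
    using Linf_Rp_measurable[OF assms(1)]
    by (intro integrable_bounded_mult[OF assms(2)] borel_measurable_lebesgue_translate AE_lebesgue_translate)
qed

lemma shifted_pairing_add:
  assumes "f \<in> Linf_Rp" "integrable lebesgue g1" "integrable lebesgue g2"
  shows "shifted_pairing f (\<lambda>x. g1 x + g2 x) s = shifted_pairing f g1 s + shifted_pairing f g2 s"
  unfolding shifted_pairing_def
  using integrable_shifted_pairing[OF assms(1,2)] integrable_shifted_pairing[OF assms(1,3)]
  by (simp add: distrib_left)

lemma shifted_pairing_mult: "shifted_pairing f (\<lambda>x. c * g x) s = c * shifted_pairing f g s"
  unfolding shifted_pairing_def by (simp add: mult.left_commute)

lemma shifted_pairing_bound:
  assumes "f \<in> Linf_Rp" "AE x in lebesgue. norm (zero_ext f x) \<le> C" "integrable lebesgue g"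
  shows "norm (shifted_pairing f g s) \<le> C * (\<integral>x. norm (g x) \<partial>lebesgue)"
  unfolding shifted_pairing_def
  using Linf_Rp_measurable[OF assms(1)] AE_lebesgue_translate[OF assms(2)]
  by (intro norm_integral_bounded_mult_le[OF assms(3)] borel_measurable_lebesgue_translate)

lemma shifted_pairing_diff_bound:
  assumes f: "f \<in> Linf_Rp" and C: "AE x in lebesgue. norm (zero_ext f x) \<le> C"
    and g: "integrable lebesgue g"
  shows "norm (shifted_pairing f g s - shifted_pairing f g s')
    \<le> C * (\<integral>y. norm (g (y + (s' - s)) - g y) \<partial>lebesgue)"
proof -
  have moved: "shifted_pairing f g a = (\<integral>x. zero_ext f x * g (x - a) \<partial>lebesgue)" for a
    using integral_lebesgue_translate[of "\<lambda>y. zero_ext f y * g (y - a)" a] by (simp add: shifted_pairing_def)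
  have g_shift: "integrable lebesgue (\<lambda>x. g (x - a))" for a
    using g integrable_lebesgue_translate_iff[of g "- a"] by simp
  have pair_integrable: "integrable lebesgue (\<lambda>x. zero_ext f x * g (x - a))" for a
    using integrable_shifted_pairing[OF f g_shift[of a], of 0] by simp
  have "shifted_pairing f g s - shifted_pairing f g s' = (\<integral>x. zero_ext f x * (g (x - s) - g (x - s')) \<partial>lebesgue)"
    unfolding moved using pair_integrable[of s] pair_integrable[of s'] by (simp add: right_diff_distrib)
  also have "norm \<dots> \<le> C * (\<integral>x. norm (g (x - s) - g (x - s')) \<partial>lebesgue)"
    using g_shift[of s] g_shift[of s']
    by (intro norm_integral_bounded_mult_le[OF _ Linf_Rp_measurable[OF f] C]) simp
  also have "(\<integral>x. norm (g (x - s) - g (x - s')) \<partial>lebesgue) = (\<integral>y. norm (g (y + (s' - s)) - g y) \<partial>lebesgue)"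
    using integral_lebesgue_translate[of "\<lambda>x. norm (g (x - s) - g (x - s'))" s'] by (simp add: algebra_simps)
  finally show ?thesis .
qed

lemma uniformly_continuous_on_pair_shift:
  assumes f: "f \<in> Linf_Rp" and g: "g \<in> L1_Rp"
  shows "uniformly_continuous_on {0..} (pair_shift f g)"
  unfolding uniformly_continuous_on_def
proof (intro allI impI)
  fix e :: real assume "e > 0"
  obtain C where "C > 0" and C: "AE x in lebesgue. norm (zero_ext f x) \<le> C" using Linf_Rp_bound[OF f] .
  have g0: "integrable lebesgue (zero_ext g)" using g by (simp add: L1_Rp_iff)
  obtain d where "d > 0" and d: "\<And>t. t \<noteq> 0 \<Longrightarrow> \<bar>t\<bar> < d \<Longrightarrow>
      (\<integral>y. norm (zero_ext g (y + t) - zero_ext g y) \<partial>lebesgue) < e / C"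
    using LIM_L1_translate[OF g0, unfolded LIM_eq, rule_format, of "e / C"] \<open>e > 0\<close> \<open>C > 0\<close> by auto
  have "dist (pair_shift f g s') (pair_shift f g s) < e" if "0 \<le> s" "0 \<le> s'" "dist s' s < d" for s s'
  proof (cases "s = s'")
    case False
    have "dist (pair_shift f g s') (pair_shift f g s)
        \<le> C * (\<integral>y. norm (zero_ext g (y + (s - s')) - zero_ext g y) \<partial>lebesgue)"
      using shifted_pairing_diff_bound[OF f C g0] that by (simp add: dist_norm pair_shift_eq_shifted_pairing)
    also have "\<dots> < C * (e / C)"
      using d[of "s - s'"] False that(3) \<open>C > 0\<close>
      by (intro mult_strict_left_mono) (auto simp: dist_real_def abs_minus_commute)
    finally show ?thesis using \<open>C > 0\<close> by simp
  qed (use \<open>e > 0\<close> in simp)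
  then show "\<exists>d>0. \<forall>s\<in>{0..}. \<forall>s'\<in>{0..}. dist s' s < d \<longrightarrow> dist (pair_shift f g s') (pair_shift f g s) < e"
    using \<open>d > 0\<close> by auto
qed

lemma ultrafilter_tendsto_shifted_pairing:
  assumes f: "f \<in> Linf_Rp" and F: "is_ultrafilter F"
  obtains h C where "h \<in> borel_measurable lebesgue" "AE x in lebesgue. norm (h x) \<le> C"
    "\<And>g. integrable lebesgue g \<Longrightarrow> (shifted_pairing f g \<longlongrightarrow> (\<integral>x. h x * g x \<partial>lebesgue)) F"
proof -
  have "F \<noteq> bot" using F by (simp add: is_ultrafilter_def)
  obtain C where "C > 0" and C: "AE x in lebesgue. norm (zero_ext f x) \<le> C" using Linf_Rp_bound[OF f] .
  define \<Lambda> where "\<Lambda> g = Lim F (shifted_pairing f g)" for g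
  have lim: "(shifted_pairing f g \<longlongrightarrow> \<Lambda> g) F" if g: "integrable lebesgue g" for g
  proof -
    obtain L where L: "(shifted_pairing f g \<longlongrightarrow> L) F"
      using is_ultrafilter_bounded_convergent[OF F, of "shifted_pairing f g"]
        shifted_pairing_bound[OF f C g] by (auto intro: always_eventually)
    moreover from L have "\<Lambda> g = L" unfolding \<Lambda>_def by (rule tendsto_Lim[OF \<open>F \<noteq> bot\<close>])
    ultimately show ?thesis by simp
  qed
  obtain h where "h \<in> borel_measurable lebesgue" "AE x in lebesgue. norm (h x) \<le> 2 * C"
    and "\<And>g. integrable lebesgue g \<Longrightarrow> \<Lambda> g = (\<integral>x. h x * g x \<partial>lebesgue)"
  proof (rule L1_dual_representation[of C \<Lambda>])
    show "\<Lambda> (\<lambda>x. g1 x + g2 x) = \<Lambda> g1 + \<Lambda> g2" if "integrable lebesgue g1" "integrable lebesgue g2" for g1 g2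
    proof -
      have "shifted_pairing f (\<lambda>x. g1 x + g2 x) = (\<lambda>s. shifted_pairing f g1 s + shifted_pairing f g2 s)"
        by (simp add: fun_eq_iff shifted_pairing_add[OF f that])
      then have "(shifted_pairing f (\<lambda>x. g1 x + g2 x) \<longlongrightarrow> \<Lambda> g1 + \<Lambda> g2) F"
        by (simp add: tendsto_add lim that)
      with lim[of "\<lambda>x. g1 x + g2 x"] that show ?thesis using tendsto_unique[OF \<open>F \<noteq> bot\<close>] by auto
    qed
    show "\<Lambda> (\<lambda>x. c * g x) = c * \<Lambda> g" if "integrable lebesgue g" for c g
    proof -
      have "shifted_pairing f (\<lambda>x. c * g x) = (\<lambda>s. c * shifted_pairing f g s)"
        by (simp add: fun_eq_iff shifted_pairing_mult)
      then have "(shifted_pairing f (\<lambda>x. c * g x) \<longlongrightarrow> c * \<Lambda> g) F"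
        by (simp add: tendsto_mult_left lim that)
      with lim[of "\<lambda>x. c * g x"] that show ?thesis using tendsto_unique[OF \<open>F \<noteq> bot\<close>] by auto
    qed
    show "norm (\<Lambda> g) \<le> C * (\<integral>x. norm (g x) \<partial>lebesgue)" if "integrable lebesgue g" for g
      using shifted_pairing_bound[OF f C that] \<open>F \<noteq> bot\<close>
      by (intro tendsto_upperbound[OF tendsto_norm[OF lim[OF that]]]) (auto intro: always_eventually)
  qed (use \<open>C > 0\<close> in auto)
  with lim that show ?thesis by metis
qed

lemma ultrafilter_weak_limit_exists:
  assumes f: "f \<in> Linf_Rp" and F: "is_ultrafilter F" "eventually (\<lambda>s. 0 \<le> s) F"
  shows "\<exists>h\<in>Linf_Rp. \<forall>g\<in>L1_Rp. ((\<lambda>s. pair_shift f g s) \<longlongrightarrow> (LINT x:{0..}|lebesgue. h x * g x)) F"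
proof -
  obtain h C where h: "h \<in> borel_measurable lebesgue" "AE x in lebesgue. norm (h x) \<le> C"
    and lim: "\<And>g. integrable lebesgue g \<Longrightarrow> (shifted_pairing f g \<longlongrightarrow> (\<integral>x. h x * g x \<partial>lebesgue)) F"
    using ultrafilter_tendsto_shifted_pairing[OF f F(1)] by blast
  have "h \<in> Linf_Rp"
    using h unfolding Linf_Rp_def set_borel_measurable_def
    by (auto intro!: exI[of _ C] borel_measurable_scaleR borel_measurable_indicator elim: eventually_mono)
  moreover have "((\<lambda>s. pair_shift f g s) \<longlongrightarrow> (LINT x:{0..}|lebesgue. h x * g x)) F" if "g \<in> L1_Rp" for g
  proof -
    have "integrable lebesgue (zero_ext g)" using that by (simp add: L1_Rp_iff)
    moreover have "(LINT x:{0..}|lebesgue. h x * g x) = (\<integral>x. h x * zero_ext g x \<partial>lebesgue)"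
      unfolding set_lebesgue_integral_def
      by (rule Bochner_Integration.integral_cong) (auto simp: zero_ext_def indicator_def)
    ultimately have "(shifted_pairing f (zero_ext g) \<longlongrightarrow> (LINT x:{0..}|lebesgue. h x * g x)) F"
      using lim by simp
    moreover have "eventually (\<lambda>s. shifted_pairing f (zero_ext g) s = pair_shift f g s) F"
      using F(2) by eventually_elim (simp add: pair_shift_eq_shifted_pairing)
    ultimately show ?thesis by (rule Lim_transform_eventually)
  qed
  ultimately show ?thesis by blast
qed

lemma AE_zero_if_orthogonal_to_truncations:
  fixes d :: "real \<Rightarrow> complex"
  assumes d: "d \<in> borel_measurable lebesgue" "AE x in lebesgue. norm (d x) \<le> C"
    and orthogonal: "\<And>n::nat. (\<integral>x. d x * (indicator {0..real n} x *\<^sub>R cnj (d x)) \<partial>lebesgue) = 0"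
  shows "AE x in lebesgue. 0 \<le> x \<longrightarrow> d x = 0"
proof -
  have "AE x in lebesgue. x \<in> {0..real n} \<longrightarrow> d x = 0" for n :: nat
  proof -
    let ?g = "\<lambda>x. indicator {0..real n} x * (norm (d x))\<^sup>2"
    have "integrable lebesgue ?g"
    proof (rule Bochner_Integration.integrable_bound)
      have "integrable lebesgue (indicat_real {0..real n})"
        by (simp add: lmeasurable_iff_integrable[symmetric])
      then show "integrable lebesgue (\<lambda>x. C\<^sup>2 * indicat_real {0..real n} x)"
        by (rule integrable_mult_right)
      show "?g \<in> borel_measurable lebesgue" using d(1) by measurable
      show "AE x in lebesgue. norm (?g x) \<le> norm (C\<^sup>2 * indicat_real {0..real n} x)"
        using d(2) by eventually_elim (simp add: indicator_def power_mono)
    qed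
    moreover have "complex_of_real (\<integral>x. ?g x \<partial>lebesgue) = 0"
      unfolding integral_complex_of_real[symmetric] orthogonal[of n, symmetric]
      by (rule Bochner_Integration.integral_cong)
        (auto simp: indicator_def complex_norm_square[symmetric] simp del: of_real_power)
    ultimately have "AE x in lebesgue. ?g x = 0"
      by (subst integral_nonneg_eq_0_iff_AE[symmetric]) auto
    then show ?thesis by eventually_elim (auto simp: indicator_def)
  qed
  then have "AE x in lebesgue. \<forall>n::nat. x \<in> {0..real n} \<longrightarrow> d x = 0"
    unfolding AE_all_countable by blast
  then show ?thesis
    by eventually_elim (metis atLeastAtMost_iff real_nat_ceiling_ge)
qed

lemma Linf_Rp_AE_eq_if_pairings_eq:
  assumes h1: "h1 \<in> Linf_Rp" and h2: "h2 \<in> Linf_Rp"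
    and pairings: "\<And>g. g \<in> L1_Rp \<Longrightarrow> (LINT x:{0..}|lebesgue. h1 x * g x) = (LINT x:{0..}|lebesgue. h2 x * g x)"
  shows "AE x in lebesgue. 0 \<le> x \<longrightarrow> h1 x = h2 x"
proof -
  obtain C1 where C1: "AE x in lebesgue. norm (zero_ext h1 x) \<le> C1" using Linf_Rp_bound[OF h1] by blast
  obtain C2 where C2: "AE x in lebesgue. norm (zero_ext h2 x) \<le> C2" using Linf_Rp_bound[OF h2] by blast
  define d where "d x = zero_ext h1 x - zero_ext h2 x" for x
  have d_measurable: "d \<in> borel_measurable lebesgue"
    unfolding d_def using Linf_Rp_measurable[OF h1] Linf_Rp_measurable[OF h2] by simp
  have d_bound: "AE x in lebesgue. norm (d x) \<le> C1 + C2"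
    using C1 C2 by eventually_elim (auto simp: d_def intro: order_trans[OF norm_triangle_ineq4])
  have "(\<integral>x. d x * (indicator {0..real n} x *\<^sub>R cnj (d x)) \<partial>lebesgue) = 0" for n :: nat
  proof -
    define g where "g x = indicator {0..real n} x *\<^sub>R cnj (d x)" for x
    have "integrable lebesgue g"
    proof (rule Bochner_Integration.integrable_bound)
      have "integrable lebesgue (indicat_real {0..real n})"
        by (simp add: lmeasurable_iff_integrable[symmetric])
      then show "integrable lebesgue (\<lambda>x. (C1 + C2) * indicat_real {0..real n} x)"
        by (rule integrable_mult_right)
      have "(\<lambda>x. cnj (d x)) \<in> borel_measurable lebesgue"
        by (rule borel_measurable_continuous_on[OF _ d_measurable]) (intro continuous_intros)
      then show "g \<in> borel_measurable lebesgue" unfolding g_def by measurable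
      show "AE x in lebesgue. norm (g x) \<le> norm ((C1 + C2) * indicat_real {0..real n} x)"
        using d_bound by eventually_elim (auto simp: g_def indicator_def)
    qed
    moreover have "zero_ext g = g" by (auto simp: fun_eq_iff zero_ext_def g_def indicator_def)
    ultimately have "g \<in> L1_Rp" "integrable lebesgue g" by (simp_all add: L1_Rp_iff)
    have pairing: "(LINT x:{0..}|lebesgue. h x * g x) = (\<integral>x. zero_ext h x * g x \<partial>lebesgue)" for h
      unfolding set_lebesgue_integral_def
      by (rule Bochner_Integration.integral_cong) (auto simp: zero_ext_def g_def indicator_def)
    have "0 = (\<integral>x. zero_ext h1 x * g x \<partial>lebesgue) - (\<integral>x. zero_ext h2 x * g x \<partial>lebesgue)"
      using pairings[OF \<open>g \<in> L1_Rp\<close>] by (simp add: pairing)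
    also have "\<dots> = (\<integral>x. d x * g x \<partial>lebesgue)"
      using integrable_bounded_mult[OF \<open>integrable lebesgue g\<close> Linf_Rp_measurable[OF h1] C1]
        integrable_bounded_mult[OF \<open>integrable lebesgue g\<close> Linf_Rp_measurable[OF h2] C2]
      by (simp add: d_def left_diff_distrib)
    finally show ?thesis by (simp add: g_def)
  qed
  from AE_zero_if_orthogonal_to_truncations[OF d_measurable d_bound this]
  show ?thesis by eventually_elim (simp add: d_def)
qed


section \<open>Omega-limits\<close>

lemma set_integral_Rp_eq_zero_ext:
  "(LINT x:{0..}|lebesgue. h x * g x) = (\<integral>x. zero_ext h x * zero_ext g x \<partial>lebesgue)"
  unfolding set_lebesgue_integral_def
  by (rule Bochner_Integration.integral_cong) (auto simp: zero_ext_def indicator_def)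

lemma is_omega_lim_f_omega_Rp:
  assumes "f \<in> Linf_Rp" "\<omega> \<in> OmegaStar"
  shows "is_omega_lim f \<omega> (f_omega_Rp f \<omega>)"
proof -
  have "\<exists>h. is_omega_lim f \<omega> h"
    using ultrafilter_weak_limit_exists[OF assms(1) omega_filter_ultrafilter[OF assms(2)]
        eventually_nonneg_omega_filter[OF assms(2)]]
    by (auto simp: is_omega_lim_def)
  then show ?thesis unfolding f_omega_Rp_def by (rule someI_ex)
qed

lemma is_omega_lim_unique:
  assumes "\<omega> \<in> OmegaStar" "is_omega_lim f \<omega> h1" "is_omega_lim f \<omega> h2"
  shows "AE x in lebesgue. 0 \<le> x \<longrightarrow> h1 x = h2 x"
  using assms(2,3) tendsto_unique[OF omega_filter_not_bot[OF assms(1)]]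
  by (intro Linf_Rp_AE_eq_if_pairings_eq) (auto simp: is_omega_lim_def, blast)

lemma AE_f_omega_Rp_eq:
  assumes "f \<in> Linf_Rp" "\<omega> \<in> OmegaStar" "is_omega_lim f \<omega> h"
  shows "AE x in lebesgue. 0 \<le> x \<longrightarrow> f_omega_Rp f \<omega> x = h x"
  using is_omega_lim_unique[OF assms(2) is_omega_lim_f_omega_Rp[OF assms(1,2)] assms(3)] .

lemma is_omega_lim_AE_cong:
  assumes lim: "is_omega_lim f \<omega> h" and h': "h' \<in> Linf_Rp"
    and eq: "AE x in lebesgue. 0 \<le> x \<longrightarrow> h x = h' x"
  shows "is_omega_lim f \<omega> h'"
proof -
  have "(LINT x:{0..}|lebesgue. h x * g x) = (LINT x:{0..}|lebesgue. h' x * g x)" if "g \<in> L1_Rp" for g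
  proof -
    have "h \<in> Linf_Rp" using lim by (simp add: is_omega_lim_def)
    moreover have "zero_ext g \<in> borel_measurable lebesgue"
      using that by (simp add: L1_Rp_iff borel_measurable_integrable)
    ultimately show ?thesis
      unfolding set_integral_Rp_eq_zero_ext
    proof (intro integral_cong_AE)
      show "AE x in lebesgue. zero_ext h x * zero_ext g x = zero_ext h' x * zero_ext g x"
        using eq by eventually_elim (auto simp: zero_ext_def indicator_def)
    qed (use Linf_Rp_measurable[OF h'] Linf_Rp_measurable in simp_all)
  qed
  with lim h' show ?thesis by (simp add: is_omega_lim_def)
qed

definition shift_right :: "real \<Rightarrow> (real \<Rightarrow> complex) \<Rightarrow> real \<Rightarrow> complex" where
  "shift_right d g x = (if d \<le> x then g (x - d) else 0)"

lemma zero_ext_shift_right: "0 \<le> d \<Longrightarrow> zero_ext (shift_right d g) = (\<lambda>x. zero_ext g (x + - d))"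
  by (auto simp: fun_eq_iff zero_ext_def shift_right_def indicator_def)

lemma shift_right_L1_Rp: "0 \<le> d \<Longrightarrow> g \<in> L1_Rp \<Longrightarrow> shift_right d g \<in> L1_Rp"
  using integrable_lebesgue_translate_iff[of "zero_ext g" "- d"] by (simp add: L1_Rp_iff zero_ext_shift_right)

lemma pair_shift_shift_right:
  assumes "0 \<le> d" "0 \<le> s"
  shows "pair_shift f (shift_right d g) s = pair_shift f g (s + d)"
proof -
  have "pair_shift f (shift_right d g) s = (\<integral>x. zero_ext f (x + s) * zero_ext g (x + - d) \<partial>lebesgue)"
    using assms by (simp add: pair_shift_eq_shifted_pairing shifted_pairing_def zero_ext_shift_right)
  also have "\<dots> = (\<integral>x. zero_ext f ((x + - d) + (s + d)) * zero_ext g (x + - d) \<partial>lebesgue)"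
    by (simp add: algebra_simps)
  also have "\<dots> = (\<integral>x. zero_ext f (x + (s + d)) * zero_ext g x \<partial>lebesgue)"
    by (rule integral_lebesgue_translate)
  also have "\<dots> = pair_shift f g (s + d)"
    using assms by (simp add: pair_shift_eq_shifted_pairing shifted_pairing_def)
  finally show ?thesis .
qed

lemma Linf_Rp_translate:
  assumes "h \<in> Linf_Rp" "0 \<le> d"
  shows "(\<lambda>x. h (x + d)) \<in> Linf_Rp"
proof -
  have "(\<lambda>x. indicator {0..} x *\<^sub>R h (x + d)) = (\<lambda>x. indicator {0..} x *\<^sub>R zero_ext h (x + d))"
    using assms(2) by (auto simp: fun_eq_iff indicator_def)
  moreover have "(\<lambda>x. zero_ext h (x + d)) \<in> borel_measurable lebesgue"
    by (rule borel_measurable_lebesgue_translate[OF Linf_Rp_measurable[OF assms(1)]])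
  ultimately have "set_borel_measurable lebesgue {0..} (\<lambda>x. h (x + d))"
    unfolding set_borel_measurable_def by (simp add: borel_measurable_scaleR borel_measurable_indicator)
  moreover obtain C where C: "AE x in lebesgue. norm (zero_ext h x) \<le> C" using Linf_Rp_bound[OF assms(1)] .
  have "AE x in lebesgue. 0 \<le> x \<longrightarrow> norm (h (x + d)) \<le> C"
    using AE_lebesgue_translate[OF C, of d] by eventually_elim (use assms(2) in \<open>auto simp: zero_ext_def\<close>)
  ultimately show ?thesis by (auto simp: Linf_Rp_def)
qed

lemma is_omega_lim_flow:
  assumes \<omega>: "\<omega> \<in> OmegaStar" and "0 \<le> d" and lim: "is_omega_lim f \<omega> h"
  shows "is_omega_lim f (flow d \<omega>) (\<lambda>x. h (x + d))"
  unfolding is_omega_lim_def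
proof (intro conjI ballI)
  show "(\<lambda>x. h (x + d)) \<in> Linf_Rp"
    using lim \<open>0 \<le> d\<close> by (simp add: is_omega_lim_def Linf_Rp_translate)
  fix g assume "g \<in> L1_Rp"
  then have "((\<lambda>s. pair_shift f (shift_right d g) s) \<longlongrightarrow> pair_shift h (shift_right d g) 0) (omega_filter \<omega>)"
    using lim shift_right_L1_Rp[OF \<open>0 \<le> d\<close>] by (simp add: is_omega_lim_def pair_shift_def)
  moreover have "eventually (\<lambda>s. pair_shift f (shift_right d g) s = pair_shift f g (s + d)) (omega_filter \<omega>)"
    using eventually_nonneg_omega_filter[OF \<omega>] by eventually_elim (simp add: pair_shift_shift_right \<open>0 \<le> d\<close>)
  ultimately have "((\<lambda>s. pair_shift f g (s + d)) \<longlongrightarrow> pair_shift h g d) (omega_filter \<omega>)"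
    using pair_shift_shift_right[OF \<open>0 \<le> d\<close> order_refl] by (simp add: Lim_transform_eventually)
  then show "((\<lambda>s. pair_shift f g s) \<longlongrightarrow> (LINT x:{0..}|lebesgue. h (x + d) * g x)) (omega_filter (flow d \<omega>))"
    by (simp add: omega_filter_flow[OF \<omega>] filterlim_filtermap pair_shift_def)
qed

lemma is_omega_lim_const_iff:
  "is_omega_lim f \<omega> (\<lambda>_. \<alpha>) \<longleftrightarrow>
    (\<forall>g\<in>L1_Rp. ((\<lambda>s. pair_shift f g s) \<longlongrightarrow> \<alpha> * (LINT x:{0..}|lebesgue. g x)) (omega_filter \<omega>))"
  by (simp add: is_omega_lim_def Linf_Rp_const set_integral_mult_right)

lemma K_is_iff_is_omega_lim_const:
  assumes f: "f \<in> Linf_Rp"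
  shows "K_is f \<alpha> \<longleftrightarrow> (\<forall>\<omega>\<in>OmegaStar. is_omega_lim f \<omega> (\<lambda>_. \<alpha>))"
proof
  assume "K_is f \<alpha>"
  then show "\<forall>\<omega>\<in>OmegaStar. is_omega_lim f \<omega> (\<lambda>_. \<alpha>)"
    by (auto simp: K_is_def is_omega_lim_const_iff intro: tendsto_mono[OF omega_filter_le_at_top])
next
  assume lim: "\<forall>\<omega>\<in>OmegaStar. is_omega_lim f \<omega> (\<lambda>_. \<alpha>)"
  show "K_is f \<alpha>"
    unfolding K_is_def
  proof
    fix g assume g: "g \<in> L1_Rp"
    let ?L = "\<alpha> * (LINT x:{0..}|lebesgue. g x)"
    have "((\<lambda>n. pair_shift f g (u + real n)) \<longlongrightarrow> ?L) sequentially" if "0 \<le> u" "u < 1" for u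
    proof (rule tendsto_sequentially_if_tendsto_Nstar)
      fix \<eta> assume "\<eta> \<in> Nstar"
      with that have "(\<eta>, u) \<in> OmegaStar" by (simp add: OmegaStar_def)
      with lim g have "((\<lambda>s. pair_shift f g s) \<longlongrightarrow> ?L) (omega_filter (\<eta>, u))"
        by (simp add: is_omega_lim_const_iff)
      then show "((\<lambda>n. pair_shift f g (u + real n)) \<longlongrightarrow> ?L) \<eta>"
        by (simp add: omega_filter_def filterlim_filtermap)
    qed
    then show "((\<lambda>s. pair_shift f g s) \<longlongrightarrow> ?L) at_top"
      by (intro uniformly_continuous_on_tendsto_at_top uniformly_continuous_on_pair_shift f g)
  qed
qed

lemma AE_f_omega_eq_f_omega_Rp_flow:
  assumes f: "f \<in> Linf_Rp" and \<omega>: "\<omega> \<in> OmegaStar"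
  shows "AE x in lebesgue. - real N \<le> x \<longrightarrow> f_omega f \<omega> x = f_omega_Rp f (flow (- real N) \<omega>) (x + real N)"
proof -
  let ?\<rho> = "flow (- real N) \<omega>"
  have \<rho>: "?\<rho> \<in> OmegaStar" by (rule flow_OmegaStar[OF \<omega>])
  have "AE x in lebesgue. 0 \<le> x + real k \<longrightarrow>
      f_omega_Rp f (flow (- real k) \<omega>) (x + real k) = f_omega_Rp f ?\<rho> (x + real N)"
    if "k \<le> N" for k
  proof -
    have "flow (real N - real k) ?\<rho> = flow (- real k) \<omega>" by (simp add: flow_add[OF \<omega>])
    then have "is_omega_lim f (flow (- real k) \<omega>) (\<lambda>y. f_omega_Rp f ?\<rho> (y + (real N - real k)))"
      using is_omega_lim_flow[OF \<rho> _ is_omega_lim_f_omega_Rp[OF f \<rho>], of "real N - real k"] that by simp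
    from AE_lebesgue_translate[OF AE_f_omega_Rp_eq[OF f flow_OmegaStar[OF \<omega>] this], of "real k"]
    show ?thesis by (simp add: algebra_simps)
  qed
  then have "AE x in lebesgue. \<forall>k. k \<le> N \<longrightarrow> 0 \<le> x + real k \<longrightarrow>
      f_omega_Rp f (flow (- real k) \<omega>) (x + real k) = f_omega_Rp f ?\<rho> (x + real N)"
    by (simp add: AE_all_countable)
  then show ?thesis
  proof eventually_elim
    case (elim x)
    show ?case
    proof
      assume "- real N \<le> x"
      show "f_omega f \<omega> x = f_omega_Rp f ?\<rho> (x + real N)"
      proof (cases "0 \<le> x")
        case True
        then show ?thesis using elim[rule_format, of 0] \<omega> by (simp add: f_omega_def)
      next
        case False
        define K where "K = nat \<lceil>- x\<rceil>"
        have "real K = of_int \<lceil>- x\<rceil>" "K \<le> N" "0 \<le> x + real K"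
          using False \<open>- real N \<le> x\<close> by (auto simp: K_def ceiling_le_iff) linarith
        with elim[rule_format, of K] False show ?thesis by (simp add: f_omega_def Let_def add.commute)
      qed
    qed
  qed
qed

lemma AE_f_omega_eq_const_iff:
  assumes f: "f \<in> Linf_Rp" and \<omega>: "\<omega> \<in> OmegaStar"
  shows "(AE x in lebesgue. f_omega f \<omega> x = \<alpha>) \<longleftrightarrow>
    (\<forall>N::nat. is_omega_lim f (flow (- real N) \<omega>) (\<lambda>_. \<alpha>))"
proof
  assume const: "AE x in lebesgue. f_omega f \<omega> x = \<alpha>"
  show "\<forall>N::nat. is_omega_lim f (flow (- real N) \<omega>) (\<lambda>_. \<alpha>)"
  proof
    fix N :: nat
    have "AE x in lebesgue. - real N \<le> x \<longrightarrow> f_omega_Rp f (flow (- real N) \<omega>) (x + real N) = \<alpha>"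
      using AE_f_omega_eq_f_omega_Rp_flow[OF f \<omega>, of N] const by eventually_elim simp
    from AE_lebesgue_translate[OF this, of "- real N"]
    have "AE y in lebesgue. 0 \<le> y \<longrightarrow> f_omega_Rp f (flow (- real N) \<omega>) y = \<alpha>" by simp
    then show "is_omega_lim f (flow (- real N) \<omega>) (\<lambda>_. \<alpha>)"
      by (intro is_omega_lim_AE_cong[OF is_omega_lim_f_omega_Rp[OF f flow_OmegaStar[OF \<omega>]] Linf_Rp_const])
  qed
next
  assume lim: "\<forall>N::nat. is_omega_lim f (flow (- real N) \<omega>) (\<lambda>_. \<alpha>)"
  have "AE x in lebesgue. - real N \<le> x \<longrightarrow> f_omega f \<omega> x = \<alpha>" for N
  proof -
    have "AE y in lebesgue. 0 \<le> y \<longrightarrow> f_omega_Rp f (flow (- real N) \<omega>) y = \<alpha>"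
      using AE_f_omega_Rp_eq[OF f flow_OmegaStar[OF \<omega>] lim[rule_format]] .
    from AE_lebesgue_translate[OF this, of "real N"] AE_f_omega_eq_f_omega_Rp_flow[OF f \<omega>, of N]
    show ?thesis by eventually_elim simp
  qed
  then have "AE x in lebesgue. \<forall>N::nat. - real N \<le> x \<longrightarrow> f_omega f \<omega> x = \<alpha>"
    unfolding AE_all_countable by blast
  then show "AE x in lebesgue. f_omega f \<omega> x = \<alpha>"
  proof eventually_elim
    case (elim x)
    obtain N where "- x \<le> real N" using real_arch_simple by blast
    then have "- real N \<le> x" by linarith
    with elim show ?case by blast
  qed
qed

lemma is_omega_lim_const_if_AE_f_omega_on_orbit:
  assumes f: "f \<in> Linf_Rp" and \<omega>: "\<omega> \<in> OmegaStar" and r: "r \<in> OmegaStar" "r = flow t \<omega>"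
    and const: "AE x in lebesgue. f_omega f r x = \<alpha>"
  shows "is_omega_lim f \<omega> (\<lambda>_. \<alpha>)"
proof -
  define N where "N = nat \<lceil>t\<rceil>"
  have "is_omega_lim f (flow (- real N) r) (\<lambda>_. \<alpha>)"
    using const AE_f_omega_eq_const_iff[OF f r(1)] by blast
  moreover have "0 \<le> real N - t" by (simp add: N_def real_nat_ceiling_ge)
  ultimately have "is_omega_lim f (flow (real N - t) (flow (- real N) r)) (\<lambda>_. \<alpha>)"
    using is_omega_lim_flow[OF flow_OmegaStar[OF r(1)]] by fastforce
  then show ?thesis using r(2) \<omega> by (simp add: flow_add)
qed

lemma orbit_reps_subset: "orbit_reps Reps \<Longrightarrow> Reps \<subseteq> OmegaStar"
  unfolding orbit_reps_def by (rule conjunct1)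

lemma orbit_reps_obtain:
  assumes "orbit_reps Reps" "\<omega> \<in> OmegaStar"
  obtains r t where "r \<in> Reps" "r = flow t \<omega>"
proof -
  have "\<exists>!r. r \<in> Reps \<and> r \<in> orbit \<omega>" using assms unfolding orbit_reps_def by blast
  then obtain r where "r \<in> Reps" "r \<in> orbit \<omega>" by (blast dest: ex1_implies_ex)
  with that show ?thesis unfolding orbit_def by blast
qed

theorem lemma2p3:
  fixes f :: "real \<Rightarrow> complex" and \<alpha> :: complex
    and Reps :: "(nat filter \<times> real) set"
  assumes "f \<in> Linf_Rp"
    and "orbit_reps Reps"
  shows "K_is f \<alpha> \<longleftrightarrow> (\<forall>\<omega> \<in> Reps. AE x in lebesgue. f_omega f \<omega> x = \<alpha>)"
proof
  assume "K_is f \<alpha>"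
  then have lim: "\<forall>\<rho>\<in>OmegaStar. is_omega_lim f \<rho> (\<lambda>_. \<alpha>)"
    using K_is_iff_is_omega_lim_const[OF assms(1)] by blast
  show "\<forall>\<omega>\<in>Reps. AE x in lebesgue. f_omega f \<omega> x = \<alpha>"
  proof
    fix \<omega> assume "\<omega> \<in> Reps"
    then have "\<omega> \<in> OmegaStar" using orbit_reps_subset[OF assms(2)] by blast
    with lim flow_OmegaStar show "AE x in lebesgue. f_omega f \<omega> x = \<alpha>"
      by (simp add: AE_f_omega_eq_const_iff[OF assms(1)])
  qed
next
  assume reps_const: "\<forall>\<omega>\<in>Reps. AE x in lebesgue. f_omega f \<omega> x = \<alpha>"
  have "is_omega_lim f \<omega> (\<lambda>_. \<alpha>)" if \<omega>: "\<omega> \<in> OmegaStar" for \<omega>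
  proof -
    obtain r t where "r \<in> Reps" "r = flow t \<omega>" using orbit_reps_obtain[OF assms(2) \<omega>] .
    with orbit_reps_subset[OF assms(2)] reps_const show ?thesis
      using is_omega_lim_const_if_AE_f_omega_on_orbit[OF assms(1) \<omega>] by blast
  qed
  then show "K_is f \<alpha>" using K_is_iff_is_omega_lim_const[OF assms(1)] by blast
qed

end
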